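(* For any $C^{1,1}$ curve $L\subset\mathbb{R}^3$, $$\mathrm{reach}(L)=\min\Bigl\{\tfrac12\min_{x,y\in L}\mathrm{pd}^*(x,y),\ \min_L\rho\Bigr\}=\min\Bigl\{\tfrac12\min_{x,y\in L}\mathrm{pd}^*(x,y),\ \min_{c\in\overline{\mathrm{Osc}L}}R(c)\Bigr\}.$$
   Context: A $C^{1,1}$ curve $L\subset\mathbb{R}^3$ is a compact embedded 1-dimensional submanifold with boundary (finite union of circles and arcs) whose arclength parametrization is $C^{1,1}$ (Lipschitz unit tangent $T$). $\mathrm{reach}(L)$ is the supremal $r\ge0$ (possibly $\infty$) such that every point at distance less than $r$ from $L$ has a unique nearest point on $L$. The tangent cone $T_xL$ is the line through $x$ tangent to $L$ (for $x\in\partial L$, the inward tangent ray), and the normal cone is $N_xL=\{p\in\mathbb{R}^3:\langle p-x,q-x\rangle\le0\text{ for all }q\in T_xL\}$ (a plane, or a closed halfspace at an endpoint). For $x\ne y$ in $L$, $\psi^*(x,y)\in[0,\frac\pi2]$ is the angle at $x$ between $N_xL$ and the segment $xy$ (so $\psi^*=0$ iff $y\in N_xL$ and $\psi^*=\frac\pi2$ iff $y\in T_xL$). The penalized endpoint distance is $\mathrm{pd}^*(x,y)=|x-y|\sec^2\psi^*(x,y)\in(0,\infty]$ for $x\neq y$, and $\mathrm{pd}^*(x,x)=\infty$. $E_L\subset L$ is the set of points where the arclength parametrization is twice differentiable (one-sidedly at endpoints), with curvature vector $\kappa(x)=T'(x)$. $\mathrm{Circ}=\{(p,T,\kappa):p\in\mathbb{R}^3,\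 |T|=1,\ \kappa\perp T\}$ is the space of oriented pointed circles and lines, with radius $R(p,T,\kappa)=1/|\kappa|\in(0,\infty]$. $\overline{\mathrm{Osc}L}$ is the closure in $\mathrm{Circ}$ of $\{(x,T(x),\kappa(x)):x\in E_L\}$, and $\rho(x)=\min\{R(c):c\in\overline{\mathrm{Osc}L}\text{ with base point }x\}$ for $x\in L$. *)

theory Defs
  imports "HOL-Analysis.Analysis"
begin

text \<open>
  A \<open>C\<^sup>1\<^sup>,\<^sup>1\<close> curve is given by a finite family of disjoint components. A component of length
  \<open>l\<close> comes with its arclength parametrization: on \<open>[0, l]\<close> for an arc, on the whole line and
  \<open>l\<close>-periodic for a circle. Derivatives are always taken within this domain, which makes them
  one-sided exactly at the endpoints of arcs.
\<close>

datatype component =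
    Arc real "real \<Rightarrow> real^3"
  | Circle real "real \<Rightarrow> real^3"

fun comp_length :: "component \<Rightarrow> real" where
  "comp_length (Arc l \<gamma>) = l"
| "comp_length (Circle l \<gamma>) = l"

fun comp_dom :: "component \<Rightarrow> real set" where
  "comp_dom (Arc l \<gamma>) = {0..l}"
| "comp_dom (Circle l \<gamma>) = UNIV"

fun comp_point :: "component \<Rightarrow> real \<Rightarrow> real^3" where
  "comp_point (Arc l \<gamma>) = \<gamma>"
| "comp_point (Circle l \<gamma>) = \<gamma>"

definition comp_image :: "component \<Rightarrow> (real^3) set" where
  "comp_image C = comp_point C ` comp_dom C"

definition comp_tangent :: "component \<Rightarrow> real \<Rightarrow> real^3" where
  "comp_tangent C s = vector_derivative (comp_point C) (at s within comp_dom C)"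

definition comp_curvature :: "component \<Rightarrow> real \<Rightarrow> real^3" where
  "comp_curvature C s = vector_derivative (comp_tangent C) (at s within comp_dom C)"

text \<open>For a circle, the condition combines periodicity with injectivity modulo the period.\<close>

fun comp_embedded :: "component \<Rightarrow> bool" where
  "comp_embedded (Arc l \<gamma>) \<longleftrightarrow> inj_on \<gamma> {0..l}"
| "comp_embedded (Circle l \<gamma>) \<longleftrightarrow> (\<forall>s t. \<gamma> s = \<gamma> t \<longleftrightarrow> (\<exists>n::int. t - s = of_int n * l))"

definition c11_component :: "component \<Rightarrow> bool" where
  "c11_component C \<longleftrightarrow>
     0 < comp_length C \<and> comp_embedded C \<and>
     (\<forall>s\<in>comp_dom C. comp_point C differentiable (at s within comp_dom C)
                     \<and> norm (comp_tangent C s) = 1) \<and>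
     (\<exists>K. K-lipschitz_on (comp_dom C) (comp_tangent C))"

text \<open>
  The parametrization \<open>\<Gamma>\<close> of \<open>L\<close> carries an orientation, which the oriented circles below depend
  on. Curves are nonempty, as minima over \<open>L\<close> are to be taken.
\<close>

definition c11_curve :: "component set \<Rightarrow> (real^3) set \<Rightarrow> bool" where
  "c11_curve \<Gamma> L \<longleftrightarrow>
     finite \<Gamma> \<and> \<Gamma> \<noteq> {} \<and> (\<forall>C\<in>\<Gamma>. c11_component C) \<and>
     disjoint_family_on comp_image \<Gamma> \<and> L = (\<Union>C\<in>\<Gamma>. comp_image C)"

definition reach :: "(real^3) set \<Rightarrow> ereal" where
  "reach L = Sup {r. 0 \<le> r \<and>
     (\<forall>p. ereal (infdist p L) < r \<longrightarrow> (\<exists>!q. q \<in> L \<and> dist p q = infdist p L))}"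

text \<open>The multiples of the unit tangent which point along the curve: inward at endpoints.\<close>

fun tangent_multiples :: "component \<Rightarrow> real \<Rightarrow> real set" where
  "tangent_multiples (Arc l \<gamma>) s = (if s = 0 then {0..} else if s = l then {..0} else UNIV)"
| "tangent_multiples (Circle l \<gamma>) s = UNIV"

definition tangent_cone :: "component set \<Rightarrow> real^3 \<Rightarrow> (real^3) set" where
  "tangent_cone \<Gamma> x =
     {x + a *\<^sub>R comp_tangent C s | C s a.
        C \<in> \<Gamma> \<and> s \<in> comp_dom C \<and> comp_point C s = x \<and> a \<in> tangent_multiples C s}"

definition normal_cone :: "component set \<Rightarrow> real^3 \<Rightarrow> (real^3) set" where
  "normal_cone \<Gamma> x = {p. \<forall>q\<in>tangent_cone \<Gamma> x. (p - x) \<bullet> (q - x) \<le> 0}"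

definition vec_angle :: "real^3 \<Rightarrow> real^3 \<Rightarrow> real" where
  "vec_angle u v = arccos ((u \<bullet> v) / (norm u * norm v))"

text \<open>The angle between a cone and a segment at its apex is the least angle with a ray of the cone.\<close>

definition psi_star :: "component set \<Rightarrow> real^3 \<Rightarrow> real^3 \<Rightarrow> real" where
  "psi_star \<Gamma> x y = (INF p\<in>normal_cone \<Gamma> x - {x}. vec_angle (p - x) (y - x))"

text \<open>In \<^typ>\<open>ereal\<close>, a positive number divided by zero is \<open>\<infinity>\<close>; this is used here and in the radius.\<close>

definition pd_star :: "component set \<Rightarrow> real^3 \<Rightarrow> real^3 \<Rightarrow> ereal" where
  "pd_star \<Gamma> x y =
     (if x = y then \<infinity> else ereal (dist x y) / ereal ((cos (psi_star \<Gamma> x y))\<^sup>2))"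

type_synonym pointed_circle = "(real^3) \<times> (real^3) \<times> (real^3)"

definition Circ :: "pointed_circle set" where
  "Circ = {(p, T, \<kappa>). norm T = 1 \<and> \<kappa> \<bullet> T = 0}"

fun base_point :: "pointed_circle \<Rightarrow> real^3" where
  "base_point (p, T, \<kappa>) = p"

fun circ_radius :: "pointed_circle \<Rightarrow> ereal" where
  "circ_radius (p, T, \<kappa>) = 1 / ereal (norm \<kappa>)"

definition Osc :: "component set \<Rightarrow> pointed_circle set" where
  "Osc \<Gamma> =
     {(comp_point C s, comp_tangent C s, comp_curvature C s) | C s.
        C \<in> \<Gamma> \<and> s \<in> comp_dom C \<and> comp_tangent C differentiable (at s within comp_dom C)}"

definition closed_Osc :: "component set \<Rightarrow> pointed_circle set" where
  "closed_Osc \<Gamma> = (top_of_set Circ) closure_of (Osc \<Gamma>)"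

definition rho :: "component set \<Rightarrow> real^3 \<Rightarrow> ereal" where
  "rho \<Gamma> x = (INF c\<in>{c \<in> closed_Osc \<Gamma>. base_point c = x}. circ_radius c)"

text \<open>
  Minima of extended-real functions are written as infima, together with this predicate.
\<close>

definition attains_Inf :: "('a \<Rightarrow> ereal) \<Rightarrow> 'a set \<Rightarrow> bool" where
  "attains_Inf f A \<longleftrightarrow> (\<exists>a\<in>A. f a = (INF b\<in>A. f b))"

end

theory Submission
  imports Defs
begin

text \<open>
  If all points at distance less than \<open>r\<close> from \<open>L\<close> have a unique nearest point, then the distance to
  \<open>L\<close> grows with slope 1 along every normal segment of length less than \<open>r\<close> (Federer), so that no
  open ball of radius \<open>r\<close> tangent to \<open>L\<close> meets \<open>L\<close>. Comparing these balls with a chord gives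
  \<open>2 r cos \<psi>\<^sup>* \<le> |x - y|\<close>, hence \<open>2 r \<le> pd\<^sup>*\<close>, and comparing them with the second order expansion of
  the curve gives \<open>r |\<kappa>| \<le> 1\<close>.

  Conversely, assume that the reach \<open>r\<close> is less than all radii of curvature. By Rademacher's theorem in
  dimension one, the tangent is Lipschitz with a constant less than \<open>1 / r\<close>, so that different nearest
  points of a center at distance about \<open>r\<close> cannot be arbitrarily close. In the limit one obtains two
  different nearest points \<open>x\<close>, \<open>y\<close> of a center at distance exactly \<open>r\<close>. If they were not antipodal,
  the nearest point projection of short segments close to the center would connect \<open>x\<close> and \<open>y\<close>
  through almost nearest points. Hence the center is their midpoint, \<open>\<psi>\<^sup>*(x, y) = 0\<close> and
  \<open>pd\<^sup>*(x, y) = 2 r\<close>.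
\<close>

text \<open>Curvature controls only pairs of feet that are close along the curve, and
  \<open>pd_star\<close> only pairs that are far apart. The link is
  \<open>distance_derivative_monotone\<close>: if the tangent is \<open>K\<close>-Lipschitz, two
  different normal feet of a center at distance below \<open>1 / K\<close> cannot be close. With a
  crude \<open>K\<close> this makes the reach positive, and positivity is the base of the rest: it
  starts the extension of normal segments, bounds the curvatures, so that the osculating circles
  form a compact set, and keeps minimizing pairs of \<open>pd_star\<close> off the diagonal. With
  the sharp constant \<open>1 / m\<close>, where \<open>m\<close> exceeds the reach but no radius of
  curvature, it keeps pairs of nearest points apart while the distances of their centers decrease to
  the reach.

  The distance to \<open>L\<close> is not treated as a differentiable function; its growth comes
  from small ascents and compactness. In the lower bound for \<open>pd_star\<close> the penalty
  enters through \<open>cos \<le> 1\<close>: from \<open>2 r cos \<le> d\<close> follows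
  \<open>d / cos^2 \<ge> 2 r / cos \<ge> 2 r\<close>.\<close>

section \<open>Lipschitz functions of one variable\<close>

text \<open>
  The density of the image of Lebesgue measure under \<open>F\<inverse>\<close>, which assigns to a set the measure of its
  image under \<open>F\<close> and is absolutely continuous because \<open>F\<close> is Lipschitz.
\<close>

lemma bilipschitz_density:
  fixes F :: "real \<Rightarrow> real"
  assumes lower: "\<And>x y. x \<le> y \<Longrightarrow> y - x \<le> F y - F x"
    and upper: "\<And>x y. x \<le> y \<Longrightarrow> F y - F x \<le> B * (y - x)"
  obtains g where "\<And>a b. a \<le> b \<Longrightarrow> (g has_integral (F b - F a)) {a..b}"
proof -
  have F_lipschitz: "\<bar>F x - F y\<bar> \<le> B * \<bar>x - y\<bar>" for x y
    using lower[of x y] upper[of x y] lower[of y x] upper[of y x]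
    by (cases x y rule: le_cases) (auto simp: abs_if)
  have B_nonneg: "0 \<le> B"
    using lower[of 0 1] upper[of 0 1] by simp
  have F_cont: "continuous_on UNIV F"
  proof (rule lipschitz_on_continuous_on)
    show "B-lipschitz_on UNIV F"
      using F_lipschitz B_nonneg by (intro lipschitz_onI) (auto simp: dist_real_def)
  qed
  have F_less: "F x < F y \<longleftrightarrow> x < y" for x y
    using lower[of x y] lower[of y x] by linarith
  have "\<exists>x. F x = y" for y
  proof -
    let ?M = "\<bar>y - F 0\<bar>"
    have "F (- ?M) \<le> y" "y \<le> F ?M"
      using lower[of "- ?M" 0] lower[of 0 ?M] by linarith+
    moreover have "continuous_on {- ?M..?M} F"
      using F_cont continuous_on_subset by blast
    ultimately show ?thesis
      using IVT'[of F "- ?M" y ?M] by auto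
  qed
  then obtain G where FG: "\<And>y. F (G y) = y" by metis
  have GF: "G (F x) = x" for x
    using F_less[of "G (F x)" x] F_less[of x "G (F x)"] FG[of "F x"] by auto
  have "continuous_on UNIV G"
  proof (rule lipschitz_on_continuous_on)
    have "\<bar>G x - G y\<bar> \<le> \<bar>x - y\<bar>" for x y
      using lower[of "G x" "G y"] lower[of "G y" "G x"] by (auto simp: FG abs_if)
    then show "1-lipschitz_on UNIV G"
      by (intro lipschitz_onI) (simp_all add: dist_real_def)
  qed
  then have [measurable]: "G \<in> borel_measurable borel"
    by (rule borel_measurable_continuous_onI)
  have vimage_G: "G -` A = F ` A" for A
    by (auto simp: GF image_iff) (metis FG)
  let ?\<mu> = "distr lborel borel G"
  have ac: "absolutely_continuous lborel ?\<mu>"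
    unfolding absolutely_continuous_def
  proof
    fix A assume A: "A \<in> null_sets (lborel :: real measure)"
    then have "negligible A"
      by (simp add: negligible_iff_null_sets null_sets_completionI)
    then have "negligible (F ` A)"
      by (rule negligible_locally_Lipschitz_image[rotated])
        (use F_lipschitz in \<open>auto intro!: exI[of _ UNIV] exI[of _ B]\<close>)
    moreover from A have [measurable]: "A \<in> sets borel"
      by (auto simp: null_sets_def)
    have "F ` A \<in> sets borel"
      unfolding vimage_G[symmetric] using measurable_sets[of G borel borel A] by simp
    ultimately have "emeasure lborel (F ` A) = 0"
      by (metis negligible_iff_emeasure0 emeasure_completion main_part sets_completionI_sets
          sets_lborel emeasure_completion)
    then have "emeasure ?\<mu> A = 0"
      by (simp add: emeasure_distr vimage_G)
    then show "A \<in> null_sets ?\<mu>"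
      by (simp add: null_sets_def)
  qed
  obtain f where f[measurable]: "f \<in> borel_measurable lborel" and density: "density lborel f = ?\<mu>"
    using sigma_finite_measure.Radon_Nikodym[OF sigma_finite_lborel ac] by auto
  have f_interval: "(\<integral>\<^sup>+x. f x * indicator {a..b} x \<partial>lborel) = ennreal (F b - F a)" if "a \<le> b" for a b
  proof -
    have "F ` {a..b} = {F a..F b}"
    proof
      show "{F a..F b} \<subseteq> F ` {a..b}"
      proof
        fix y assume "y \<in> {F a..F b}"
        then have "G y \<in> {a..b}"
          using F_less FG by (metis atLeastAtMost_iff linorder_not_le)
        then show "y \<in> F ` {a..b}"
          using FG[of y] by (metis imageI)
      qed
    qed (use F_less in \<open>auto simp: not_less[symmetric]\<close>)
    then have "emeasure ?\<mu> {a..b} = ennreal (F b - F a)"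
      using that lower[OF that] by (simp add: emeasure_distr vimage_G)
    then show ?thesis
      by (subst (asm) density[symmetric], subst (asm) emeasure_density) auto
  qed
  have "AE x in lborel. f x * indicator {- real n..real n} x \<noteq> \<infinity>" for n
    by (rule nn_integral_PInf_AE) (use f_interval[of "- real n" "real n"] in auto)
  then have "AE x in lborel. \<forall>n. f x * indicator {- real n..real n} x \<noteq> \<infinity>"
    by (simp add: AE_all_countable)
  then have f_finite: "AE x in lborel. f x \<noteq> \<infinity>"
  proof eventually_elim
    case (elim x)
    obtain n where "\<bar>x\<bar> \<le> real n"
      using real_arch_simple by blast
    then have "x \<in> {- real n..real n}" by (auto simp: abs_le_iff)
    then show ?case using elim[rule_format, of n] by simp
  qed
  show ?thesis
  proof
    fix a b :: real assume "a \<le> b"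
    have "(\<integral>\<^sup>+x. ennreal (enn2real (f x) * indicator {a..b} x) \<partial>lborel)
          = (\<integral>\<^sup>+x. f x * indicator {a..b} x \<partial>lborel)"
    proof (rule nn_integral_cong_AE)
      show "AE x in lborel. ennreal (enn2real (f x) * indicator {a..b} x) = f x * indicator {a..b} x"
        using f_finite by eventually_elim (auto simp: indicator_def less_top)
    qed
    then have "((\<lambda>x. enn2real (f x) * indicator {a..b} x) has_integral (F b - F a)) UNIV"
      using f_interval[OF \<open>a \<le> b\<close>] lower[OF \<open>a \<le> b\<close>] \<open>a \<le> b\<close>
      by (intro nn_integral_has_integral) (auto intro!: borel_measurable_times)
    moreover have "(\<lambda>x. enn2real (f x) * indicator {a..b} x)
        = (\<lambda>x. if x \<in> {a..b} then enn2real (f x) else 0)"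
      by (auto simp: indicator_def)
    ultimately show "((\<lambda>x. enn2real (f x)) has_integral (F b - F a)) {a..b}"
      by (simp only: has_integral_restrict_UNIV)
  qed
qed

text \<open>This is Lebesgue differentiation for averages over cubes with corner \<open>x\<close>.
  On the line these are the intervals to the right of \<open>x\<close>, hence the one-sided
  conclusion.\<close>

lemma AE_right_derivative_of_density:
  fixes f g :: "real \<Rightarrow> real"
  assumes g: "\<And>a b. a \<le> b \<Longrightarrow> (g has_integral (f b - f a)) {a..b}"
  obtains N where "negligible N"
    "\<And>x. x \<notin> N \<Longrightarrow> (f has_real_derivative g x) (at_right x)"
proof -
  have "g integrable_on cbox a b" for a b
    using g[of a b] by (cases "a \<le> b") auto
  from integrable_ccontinuous_explicit[OF this] obtain N where N: "negligible N"
    and lim: "\<And>x e. x \<notin> N \<Longrightarrow> 0 < e \<Longrightarrow> \<exists>d>0. \<forall>h. 0 < h \<and> h < d \<longrightarrow>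
      norm (integral (cbox x (x + h *\<^sub>R One)) g /\<^sub>R h ^ DIM(real) - g x) < e"
    by metis
  show ?thesis
  proof (rule that[OF N])
    fix x assume x: "x \<notin> N"
    show "(f has_real_derivative g x) (at_right x)"
      unfolding has_field_derivative_iff
    proof (rule tendstoI)
      fix e :: real assume "0 < e"
      from lim[OF x this] obtain d where "0 < d" and
        d: "\<And>h. 0 < h \<Longrightarrow> h < d \<Longrightarrow> \<bar>integral {x..x + h} g / h - g x\<bar> < e"
        by (auto simp: divide_inverse mult.commute)
      have "dist ((f y - f x) / (y - x)) (g x) < e" if "x < y" "y < x + d" for y
        using d[of "y - x"] that integral_unique[OF g[of x y]] by (simp add: dist_real_def)
      then show "\<forall>\<^sub>F y in at_right x. dist ((f y - f x) / (y - x)) (g x) < e"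
        unfolding eventually_at_right_field using \<open>0 < d\<close> by (intro exI[of _ "x + d"]) auto
    qed
  qed
qed

text \<open>The left derivative is the right derivative of the reflected function
  \<open>- f (- x)\<close>, which has the density \<open>g (- x)\<close>.\<close>

lemma AE_derivative_of_density:
  fixes f g :: "real \<Rightarrow> real"
  assumes g: "\<And>a b. a \<le> b \<Longrightarrow> (g has_integral (f b - f a)) {a..b}"
  obtains N where "negligible N"
    "\<And>x. x \<notin> N \<Longrightarrow> (f has_real_derivative g x) (at x)"
proof -
  obtain N1 where N1: "negligible N1"
    and right: "\<And>x. x \<notin> N1 \<Longrightarrow> (f has_real_derivative g x) (at_right x)"
    using AE_right_derivative_of_density[OF g] by metis
  have "((\<lambda>x. g (- x)) has_integral (- f (- b) - - f (- a))) {a..b}" if "a \<le> b" for a b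
    using g[of "- b" "- a"] that has_integral_reflect_real[of g "f (- a) - f (- b)" "- a" "- b"] by simp
  then obtain N2 where N2: "negligible N2"
    and left: "\<And>x. x \<notin> N2 \<Longrightarrow> ((\<lambda>x. - f (- x)) has_real_derivative g (- x)) (at_right x)"
    by (rule AE_right_derivative_of_density) (fast | rule that)+
  show ?thesis
  proof (rule that)
    show "negligible (N1 \<union> uminus ` N2)"
      using N1 N2 by (intro negligible_Un negligible_differentiable_image_negligible)
        (auto simp: differentiable_on_def)
    fix x assume x: "x \<notin> N1 \<union> uminus ` N2"
    then have "- x \<notin> N2" by (metis UnI2 add.inverse_inverse imageI)
    then have "((\<lambda>y. (- f (- y) + f x) / (y + x)) \<longlongrightarrow> g x) (at_right (- x))"
      using left[of "- x"] by (simp add: has_field_derivative_iff)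
    then have "((\<lambda>y. (- f y + f x) / (- y + x)) \<longlongrightarrow> g x) (at_left x)"
      by (simp add: at_left_minus filterlim_filtermap add.commute)
    then have "((\<lambda>y. (f y - f x) / (y - x)) \<longlongrightarrow> g x) (at_left x)"
      by (rule Lim_transform_eventually)
        (auto simp: eventually_at_filter field_simps)
    then have "(f has_real_derivative g x) (at_left x)"
      by (simp add: has_field_derivative_iff)
    moreover have "(f has_real_derivative g x) (at_right x)"
      using right x by auto
    ultimately show "(f has_real_derivative g x) (at x)"
      by (simp add: has_field_derivative_iff filterlim_at_split)
  qed
qed

text \<open>Adding \<open>(K + 1) * x\<close> to \<open>f\<close> gives a function with slopes
  between \<open>1\<close> and \<open>2 * K + 1\<close>, as \<open>bilipschitz_density\<close>
  requires; the constant is subtracted from the density again.\<close>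

lemma lipschitz_real_AE_derivative:
  fixes f :: "real \<Rightarrow> real"
  assumes "K-lipschitz_on UNIV f"
  obtains g N where "negligible N"
    "\<And>x. x \<notin> N \<Longrightarrow> (f has_real_derivative g x) (at x)"
    "\<And>a b. a \<le> b \<Longrightarrow> (g has_integral (f b - f a)) {a..b}"
proof -
  have f: "\<bar>f y - f x\<bar> \<le> K * \<bar>y - x\<bar>" for x y
    using lipschitz_onD[OF assms, of y x] by (simp add: dist_real_def)
  define F where "F x = f x + (K + 1) * x" for x
  obtain g where g: "\<And>a b. a \<le> b \<Longrightarrow> (g has_integral (F b - F a)) {a..b}"
  proof (rule bilipschitz_density)
    fix x y :: real assume "x \<le> y"
    then show "y - x \<le> F y - F x" "F y - F x \<le> (2 * K + 1) * (y - x)"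
      using f[of y x] by (auto simp: F_def abs_le_iff algebra_simps)
  qed metis
  have f_int: "((\<lambda>x. g x - (K + 1)) has_integral (f b - f a)) {a..b}" if "a \<le> b" for a b
    using has_integral_diff[OF g[OF that] has_integral_const_real[of "K + 1" a b]] that
    by (simp add: F_def algebra_simps)
  from AE_derivative_of_density[OF this] f_int that show ?thesis by metis
qed

lemma lipschitz_AE_vector_derivative:
  fixes f :: "real \<Rightarrow> 'a :: euclidean_space"
  assumes "K-lipschitz_on UNIV f"
  obtains g N where "negligible N"
    "\<And>x. x \<notin> N \<Longrightarrow> (f has_vector_derivative g x) (at x)"
    "\<And>a b. a \<le> b \<Longrightarrow> (g has_integral (f b - f a)) {a..b}"
proof -
  have "K-lipschitz_on UNIV (\<lambda>x. f x \<bullet> i)" if "i \<in> Basis" for i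
  proof (rule lipschitz_onI)
    fix x y
    have "dist (f x \<bullet> i) (f y \<bullet> i) \<le> dist (f x) (f y)"
      using that by (simp add: dist_real_def inner_diff_left[symmetric] dist_norm Basis_le_norm)
    then show "dist (f x \<bullet> i) (f y \<bullet> i) \<le> K * dist x y"
      using lipschitz_onD[OF assms, of x y] by simp
  qed (use lipschitz_on_nonneg[OF assms] in auto)
  then have "\<forall>i\<in>Basis. \<exists>g N. negligible N \<and>
      (\<forall>x. x \<notin> N \<longrightarrow> ((\<lambda>x. f x \<bullet> i) has_real_derivative g x) (at x)) \<and>
      (\<forall>a b. a \<le> b \<longrightarrow> (g has_integral (f b \<bullet> i - f a \<bullet> i)) {a..b})"
    by (metis (no_types, lifting) lipschitz_real_AE_derivative)
  then obtain g N where N: "\<And>i. i \<in> Basis \<Longrightarrow> negligible (N i)"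
    and deriv: "\<And>i x. i \<in> Basis \<Longrightarrow> x \<notin> N i \<Longrightarrow> ((\<lambda>x. f x \<bullet> i) has_real_derivative g i x) (at x)"
    and int: "\<And>i a b. i \<in> Basis \<Longrightarrow> a \<le> b \<Longrightarrow> (g i has_integral (f b \<bullet> i - f a \<bullet> i)) {a..b}"
    by metis
  show ?thesis
  proof (rule that)
    show "negligible (\<Union>i\<in>Basis. N i)"
      using N by (intro negligible_Union) auto
    show "(f has_vector_derivative (\<Sum>i\<in>Basis. g i x *\<^sub>R i)) (at x)" if "x \<notin> (\<Union>i\<in>Basis. N i)" for x
    proof -
      have "((\<lambda>x. \<Sum>i\<in>Basis. (f x \<bullet> i) *\<^sub>R i) has_vector_derivative
          (\<Sum>i\<in>Basis. g i x *\<^sub>R i)) (at x)"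
      proof (rule has_vector_derivative_sum)
        fix i :: 'a assume "i \<in> Basis"
        then have "((\<lambda>x. f x \<bullet> i) has_real_derivative g i x) (at x)"
          using deriv that by blast
        then show "((\<lambda>x. (f x \<bullet> i) *\<^sub>R i) has_vector_derivative g i x *\<^sub>R i) (at x)"
          using has_vector_derivative_scaleR[OF _ has_vector_derivative_const] by fastforce
      qed
      then show ?thesis
        by (simp only: euclidean_representation)
    qed
    show "((\<lambda>x. \<Sum>i\<in>Basis. g i x *\<^sub>R i) has_integral (f b - f a)) {a..b}" if "a \<le> b" for a b
    proof -
      have "((\<lambda>x. \<Sum>i\<in>Basis. g i x *\<^sub>R i) has_integral
          (\<Sum>i\<in>Basis. (f b \<bullet> i - f a \<bullet> i) *\<^sub>R i)) {a..b}"
      proof (rule has_integral_sum[OF finite_Basis])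
        fix i :: 'a assume "i \<in> Basis"
        show "((\<lambda>x. g i x *\<^sub>R i) has_integral (f b \<bullet> i - f a \<bullet> i) *\<^sub>R i) {a..b}"
          by (rule has_integral_scaleR_left[OF int[OF \<open>i \<in> Basis\<close> that]])
      qed
      then show ?thesis
        by (simp only: inner_diff_left[symmetric] euclidean_representation)
    qed
  qed
qed

lemma lipschitz_interval_AE_vector_derivative:
  fixes f :: "real \<Rightarrow> 'a :: euclidean_space"
  assumes f: "K-lipschitz_on {a..b} f" and "a \<le> b"
  obtains g N where "negligible N"
    "\<And>x. x \<in> {a<..<b} - N \<Longrightarrow> (f has_vector_derivative g x) (at x)"
    "(g has_integral (f b - f a)) {a..b}"
proof -
  \<comment> \<open>Extending \<open>f\<close> by its boundary values keeps the Lipschitz constant.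
    The derivatives of \<open>h\<close> and \<open>f\<close> are compared only inside the
    interval.\<close>
  define h where "h x = f (max a (min b x))" for x
  have "K-lipschitz_on UNIV h"
  proof (rule lipschitz_onI)
    fix x y :: real
    have "dist (h x) (h y) \<le> K * dist (max a (min b x)) (max a (min b y))"
      unfolding h_def using \<open>a \<le> b\<close> by (intro lipschitz_onD[OF f]) auto
    also have "\<dots> \<le> K * dist x y"
      using lipschitz_on_nonneg[OF f]
      by (intro mult_left_mono) (auto simp: dist_real_def)
    finally show "dist (h x) (h y) \<le> K * dist x y" .
  qed (use lipschitz_on_nonneg[OF f] in auto)
  then obtain g N where N: "negligible N"
    and deriv: "\<And>x. x \<notin> N \<Longrightarrow> (h has_vector_derivative g x) (at x)"
    and int: "\<And>a b. a \<le> b \<Longrightarrow> (g has_integral (h b - h a)) {a..b}"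
    using lipschitz_AE_vector_derivative by metis
  show ?thesis
  proof (rule that[OF N])
    fix x assume x: "x \<in> {a<..<b} - N"
    show "(f has_vector_derivative g x) (at x)"
      by (rule has_vector_derivative_transform_within_open[of h _ _ "{a<..<b}"])
        (use deriv x in \<open>auto simp: h_def\<close>)
  qed (use int[OF \<open>a \<le> b\<close>] \<open>a \<le> b\<close> in \<open>simp add: h_def\<close>)
qed

text \<open>A nonempty open interval is not negligible. Applied to tangents, this yields osculating
  circles near every point of the curve.\<close>

lemma lipschitz_differentiability_dense:
  fixes f :: "real \<Rightarrow> 'a :: euclidean_space"
  assumes "K-lipschitz_on {a..b} f" "a < b"
  obtains x where "a < x" "x < b" "f differentiable (at x)"
proof -
  obtain g N where N: "negligible N"
    and deriv: "\<And>x. x \<in> {a<..<b} - N \<Longrightarrow> (f has_vector_derivative g x) (at x)"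
    using lipschitz_interval_AE_vector_derivative[OF assms(1)] assms(2) by (metis less_imp_le)
  have "\<not> {a<..<b} \<subseteq> N"
    using N assms(2) negligible_subset open_not_negligible[of "{a<..<b}"] by auto
  with deriv that show ?thesis
    by (metis DiffI greaterThanLessThan_iff subsetI differentiableI_vector)
qed

text \<open>Integrating the component of the derivative in the direction \<open>u\<close> of the
  total increment gives the norm of the increment. This turns bounds on the curvature, which exists
  only almost everywhere, into Lipschitz bounds for the tangent.\<close>

lemma lipschitz_bound_from_derivative:
  fixes f :: "real \<Rightarrow> 'a :: euclidean_space"
  assumes f: "K-lipschitz_on {a..b} f" and "a \<le> b"
    and bound: "\<And>x D. a < x \<Longrightarrow> x < b \<Longrightarrow> (f has_vector_derivative D) (at x) \<Longrightarrow> norm D \<le> k"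
  shows "norm (f b - f a) \<le> k * (b - a)"
proof (cases "f b = f a \<or> a = b")
  case False
  obtain g N where N: "negligible N"
    and deriv: "\<And>x. x \<in> {a<..<b} - N \<Longrightarrow> (f has_vector_derivative g x) (at x)"
    and int: "(g has_integral (f b - f a)) {a..b}"
    using lipschitz_interval_AE_vector_derivative[OF f \<open>a \<le> b\<close>] by metis
  define u where "u = sgn (f b - f a)"
  \<comment> \<open>The endpoints join the exceptional set because \<open>deriv\<close> covers the
    open interval only; on \<open>S\<close> the integrand is replaced by \<open>k\<close>
    itself.\<close>
  define S where "S = N \<union> {a, b}"
  have "norm u = 1" using False by (simp add: u_def norm_sgn)
  have "((\<lambda>x. g x \<bullet> u) has_integral ((f b - f a) \<bullet> u)) {a..b}"
    using has_integral_linear[OF int bounded_linear_inner_left] by (simp add: o_def)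
  then have "((\<lambda>x. if x \<in> S then k else g x \<bullet> u) has_integral ((f b - f a) \<bullet> u)) {a..b}"
    by (rule has_integral_spike[rotated 2, where S=S]) (auto simp: S_def N)
  then have "(f b - f a) \<bullet> u \<le> k * (b - a)"
  proof (rule has_integral_le)
    show "((\<lambda>_. k) has_integral k * (b - a)) {a..b}"
      using has_integral_const_real[of k a b] \<open>a \<le> b\<close> by (simp add: mult.commute)
    fix x assume "x \<in> {a..b}"
    have "g x \<bullet> u \<le> k" if "x \<notin> S"
    proof -
      have "norm (g x) \<le> k"
        using \<open>x \<in> {a..b}\<close> that deriv by (intro bound[of x]) (auto simp: S_def)
      moreover have "g x \<bullet> u \<le> norm (g x)"
        using norm_cauchy_schwarz[of "g x" u] \<open>norm u = 1\<close> by simp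
      ultimately show ?thesis by simp
    qed
    then show "(if x \<in> S then k else g x \<bullet> u) \<le> k" by simp
  qed
  moreover have "(f b - f a) \<bullet> u = norm (f b - f a)"
    using False by (simp add: u_def sgn_div_norm power2_norm_eq_inner[symmetric] power2_eq_square)
  ultimately show ?thesis by simp
next
  case True
  \<comment> \<open>No sign of \<open>k\<close> is assumed: if \<open>a < b\<close>, a point of
    differentiability exists, and the norm of its derivative is at most \<open>k\<close>.\<close>
  have "0 \<le> k * (b - a)"
  proof (cases "a = b")
    case False
    then obtain x where "a < x" "x < b" "f differentiable (at x)"
      using lipschitz_differentiability_dense[OF f] \<open>a \<le> b\<close> by (metis order_le_less)
    then have "0 \<le> k"
      using bound[of x] by (metis norm_ge_zero order_trans vector_derivative_works)
    with \<open>a \<le> b\<close> show ?thesis by simp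
  qed simp
  with True show ?thesis by auto
qed

section \<open>Nearest points of closed sets\<close>

text \<open>The condition under the supremum in \<open>reach\<close>, at real levels, so that the
  metric arguments stay free of extended reals. It is silent about points at distance exactly
  \<open>r\<close>.\<close>

definition unique_nearest :: "'a::metric_space set \<Rightarrow> real \<Rightarrow> bool" where
  "unique_nearest L r \<longleftrightarrow> (\<forall>p. infdist p L < r \<longrightarrow> (\<exists>!q. q \<in> L \<and> dist p q = infdist p L))"

lemma unique_nearestD:
  assumes "unique_nearest L r" "infdist p L < r" "q \<in> L" "dist p q = infdist p L"
    "q' \<in> L" "dist p q' = infdist p L"
  shows "q = q'"
  using assms unfolding unique_nearest_def by blast

lemma nearest_point_exists:
  fixes L :: "'a::heine_borel set"
  assumes "closed L" "L \<noteq> {}"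
  obtains q where "q \<in> L" "dist p q = infdist p L"
  using infdist_attains_inf[OF assms, of p] by metis

lemma infdist_dist_le: "infdist p L \<le> infdist q L + dist p q"
  using infdist_triangle[of p L q] by simp

text \<open>The points of \<open>L\<close> outside the ball around \<open>q\<close> are farther from
  \<open>p\<close> than \<open>q\<close> by a definite gap. A nearest point of \<open>p'\<close>
  exceeds the distance from \<open>p\<close> to \<open>L\<close> by at most
  \<open>2 * dist p p'\<close>, so half the gap serves as \<open>d\<close>.\<close>

lemma nearest_point_continuous:
  fixes L :: "'a::heine_borel set"
  assumes L: "closed L" and q: "q \<in> L"
    and unique: "\<And>q'. q' \<in> L \<Longrightarrow> dist p q' = infdist p L \<Longrightarrow> q' = q"
    and "0 < \<eta>"
  obtains d where "0 < d"
    "\<And>p' q'. dist p p' < d \<Longrightarrow> q' \<in> L \<Longrightarrow> dist p' q' = infdist p' L \<Longrightarrow> dist q' q < \<eta>"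
proof -
  define K where "K = L \<inter> cball p (infdist p L + 2) - ball q \<eta>"
  have near: "q' \<in> K" "dist p q' \<le> infdist p L + 2 * dist p p'"
    if "dist p p' < 1" "q' \<in> L" "dist p' q' = infdist p' L" "\<not> dist q' q < \<eta>" for p' q'
  proof -
    show "dist p q' \<le> infdist p L + 2 * dist p p'"
      using dist_triangle[of p q' p'] infdist_dist_le[of p' L p] that by (simp add: dist_commute)
    with that show "q' \<in> K" by (auto simp: K_def dist_commute)
  qed
  show ?thesis
  proof (cases "K = {}")
    case True
    then show ?thesis using near(1) that[of 1] by auto
  next
    case False
    have "closed K"
      unfolding K_def using L by (intro closed_Diff closed_Int) auto
    then obtain k where k: "k \<in> K" "dist p k = infdist p K"
      using False nearest_point_exists by blast
    have "infdist p L < infdist p K"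
    proof -
      have "k \<noteq> q" "k \<in> L" using k \<open>0 < \<eta>\<close> by (auto simp: K_def)
      then show ?thesis
        using unique[of k] infdist_le[of k L p] k(2) by fastforce
    qed
    show ?thesis
    proof (rule that)
      show "0 < min 1 ((infdist p K - infdist p L) / 2)"
        using \<open>infdist p L < infdist p K\<close> by simp
      fix p' q' assume *: "dist p p' < min 1 ((infdist p K - infdist p L) / 2)"
        "q' \<in> L" "dist p' q' = infdist p' L"
      show "dist q' q < \<eta>"
      proof (rule ccontr)
        assume "\<not> dist q' q < \<eta>"
        then have "q' \<in> K" "dist p q' \<le> infdist p L + 2 * dist p p'"
          using near * by auto
        then show False
          using infdist_le[of q' K p] * by (simp add: field_simps)
      qed
    qed
  qed
qed

text \<open>Moving from \<open>z\<close> straight away from its nearest point \<open>q\<close> works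
  because the nearest points of \<open>z'\<close> are close to \<open>q\<close>, hence almost
  exactly behind, and the distance to each of them grows with slope at least
  \<open>1 - e\<close>.\<close>

lemma infdist_ascent:
  fixes L :: "'a::euclidean_space set"
  assumes L: "closed L" "L \<noteq> {}" and unique: "unique_nearest L r"
    and z: "0 < infdist z L" "infdist z L < r" and "0 < e" "e < 1" "0 < d"
  obtains z' where "z' \<noteq> z" "dist z z' < d"
    "infdist z L + (1 - e) * dist z z' \<le> infdist z' L"
proof -
  obtain q where q: "q \<in> L" "dist z q = infdist z L"
    using nearest_point_exists[OF L] by blast
  define u where "u = sgn (z - q)"
  \<comment> \<open>Positivity of \<open>\<phi> x\<close> says that the cosine of the angle between
    \<open>u\<close> and \<open>z - x\<close> exceeds \<open>1 - e\<close>: an open condition which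
    holds at \<open>q\<close>.\<close>
  define \<phi> where "\<phi> x = u \<bullet> (z - x) - (1 - e) * norm (z - x)" for x
  have "norm (z - q) > 0" using q z by (simp add: dist_norm)
  then have u: "norm u = 1" "u \<bullet> (z - q) = norm (z - q)"
    by (auto simp: u_def norm_sgn sgn_div_norm power2_norm_eq_inner[symmetric] power2_eq_square)
  have "isCont \<phi> q"
    unfolding \<phi>_def by (intro continuous_intros)
  moreover have "\<phi> q > 0"
    using \<open>0 < e\<close> \<open>norm (z - q) > 0\<close> u by (simp add: \<phi>_def algebra_simps)
  ultimately have "\<forall>\<^sub>F x in nhds q. \<phi> x > 0"
    by (simp add: isCont_def order_tendstoD tendsto_at_iff_tendsto_nhds)
  then obtain \<eta> where "0 < \<eta>" and \<eta>: "\<And>x. dist x q < \<eta> \<Longrightarrow> \<phi> x > 0"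
    unfolding eventually_nhds_metric by blast
  have "q' = q" if "q' \<in> L" "dist z q' = infdist z L" for q'
    using unique_nearestD[OF unique z(2)] q that by blast
  from nearest_point_continuous[OF L(1) q(1) this \<open>0 < \<eta>\<close>]
  obtain d' where "0 < d'" and
    d': "\<And>p' q'. dist z p' < d' \<Longrightarrow> q' \<in> L \<Longrightarrow> dist p' q' = infdist p' L \<Longrightarrow> dist q' q < \<eta>"
    by metis
  define h where "h = min d d' / 2"
  have h: "0 < h" "h < d" "h < d'"
    using \<open>0 < d\<close> \<open>0 < d'\<close> by (auto simp: h_def min_def)
  define z' where "z' = z + h *\<^sub>R u"
  have dist_z': "dist z z' = h" using h u by (simp add: z'_def dist_norm)
  obtain q' where q': "q' \<in> L" "dist z' q' = infdist z' L"
    using nearest_point_exists[OF L] by blast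
  have "\<phi> q' > 0" using \<eta> d' q' h dist_z' by blast
  have "(norm (z - q') + (1 - e) * h)\<^sup>2 \<le> (norm (z' - q'))\<^sup>2"
  proof -
    have "(norm (z' - q'))\<^sup>2 = (norm (z - q'))\<^sup>2 + 2 * h * (u \<bullet> (z - q')) + h\<^sup>2"
    proof -
      have "z' - q' = (z - q') + h *\<^sub>R u" by (simp add: z'_def)
      then have "(norm (z' - q'))\<^sup>2 = (norm (z - q'))\<^sup>2 + 2 * h * (u \<bullet> (z - q')) + h\<^sup>2 * (u \<bullet> u)"
        unfolding power2_norm_eq_inner
        by (simp add: inner_commute power2_eq_square algebra_simps)
      then show ?thesis
        using u(1) by (simp add: power2_norm_eq_inner[symmetric])
    qed
    moreover have "(1 - e) * norm (z - q') \<le> u \<bullet> (z - q')"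
      using \<open>\<phi> q' > 0\<close> by (simp add: \<phi>_def)
    then have "2 * h * ((1 - e) * norm (z - q')) \<le> 2 * h * (u \<bullet> (z - q'))"
      using h by (intro mult_left_mono) auto
    moreover have "((1 - e) * h)\<^sup>2 \<le> h\<^sup>2"
      using \<open>0 < e\<close> \<open>e < 1\<close> h by (intro power_mono) (auto simp: mult_left_le_one_le)
    ultimately show ?thesis
      unfolding power2_sum by (simp add: algebra_simps)
  qed
  then have "norm (z - q') + (1 - e) * h \<le> norm (z' - q')"
    by (rule power2_le_imp_le) simp
  then have "infdist z L + (1 - e) * h \<le> infdist z' L"
    using infdist_le[OF q'(1), of z] q'(2) by (simp add: dist_norm)
  then show ?thesis
    using that[of z'] dist_z' h by auto
qed

text \<open>
  Ekeland's device: the maximum of the distance to \<open>L\<close> over the points of the ball which are reached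
  at slope at least \<open>1 - e\<close> lies on the sphere, because the distance ascends further from any interior
  point.
\<close>

lemma infdist_increase_on_sphere:
  fixes L :: "'a::euclidean_space set"
  assumes L: "closed L" "L \<noteq> {}" and unique: "unique_nearest L r"
    and s: "0 < s" "s < infdist p L" "infdist p L + s < r"
  obtains z where "dist p z = s" "infdist z L = infdist p L + s"
proof -
  have slope: "\<exists>z\<in>sphere p s. infdist p L + (1 - e) * s \<le> infdist z L" if e: "0 < e" "e < 1" for e
  proof -
    define A where "A = cball p s \<inter> {z. infdist p L + (1 - e) * dist p z \<le> infdist z L}"
    have "compact A"
      unfolding A_def
      by (intro compact_Int_closed compact_cball closed_Collect_le continuous_intros)
    moreover have "p \<in> A" using s by (simp add: A_def)
    moreover have "continuous_on A (\<lambda>z. infdist z L)"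
      by (intro continuous_intros)
    ultimately obtain z where z: "z \<in> A" and max: "\<And>y. y \<in> A \<Longrightarrow> infdist y L \<le> infdist z L"
      using continuous_attains_sup[of A "\<lambda>z. infdist z L"] by blast
    have "dist p z = s"
    proof (rule ccontr)
      assume "dist p z \<noteq> s"
      with z have "0 < s - dist p z" by (auto simp: A_def)
      \<comment> \<open>The assumption \<open>s < infdist p L\<close> keeps the ball off
        \<open>L\<close>, and \<open>infdist p L + s < r\<close> keeps it where nearest points are
        unique.\<close>
      moreover have "0 < infdist z L" "infdist z L < r"
        using z s infdist_dist_le[of p L z] infdist_dist_le[of z L p]
        by (auto simp: A_def dist_commute)
      ultimately obtain z' where z': "z' \<noteq> z" "dist z z' < s - dist p z"
        "infdist z L + (1 - e) * dist z z' \<le> infdist z' L"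
        using infdist_ascent[OF L unique _ _ e] by metis
      have "(1 - e) * dist p z' \<le> (1 - e) * dist p z + (1 - e) * dist z z'"
        using e dist_triangle[of p z' z]
        by (metis diff_gt_0_iff_gt distrib_left mult_left_mono less_imp_le)
      moreover have "dist p z' \<le> s"
        using z'(2) dist_triangle[of p z' z] by simp
      ultimately have "z' \<in> A"
        using z z'(3) by (auto simp: A_def)
      moreover have "0 < (1 - e) * dist z z'"
        using z'(1) e by simp
      ultimately show False
        using max[of z'] z'(3) by linarith
    qed
    then show ?thesis
      using z by (auto simp: A_def)
  qed
  have "sphere p s \<noteq> {}" using slope[of "1/2"] by auto
  moreover have "continuous_on (sphere p s) (\<lambda>z. infdist z L)"
    by (intro continuous_intros)
  ultimately obtain z where z: "z \<in> sphere p s"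
    and max: "\<And>y. y \<in> sphere p s \<Longrightarrow> infdist y L \<le> infdist z L"
    using continuous_attains_sup[of "sphere p s" "\<lambda>z. infdist z L"] by auto
  \<comment> \<open>The maximum over the compact sphere dominates the points found for every slope
    \<open>1 - e\<close>, so \<open>e\<close> can tend to 0.\<close>
  have "infdist p L + s \<le> infdist z L"
  proof (rule field_le_epsilon)
    fix c :: real assume "0 < c"
    define e where "e = min (1 / 2) (c / s)"
    have e: "0 < e" "e < 1" "e * s \<le> c"
      using \<open>0 < c\<close> s by (auto simp: e_def min_def field_simps)
    then obtain y where "y \<in> sphere p s" "infdist p L + (1 - e) * s \<le> infdist y L"
      using slope by blast
    with max[of y] e(3) show "infdist p L + s \<le> infdist z L + c"
      by (simp add: algebra_simps)
  qed
  moreover have "infdist z L \<le> infdist p L + s"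
    using infdist_dist_le[of z L p] z by (simp add: dist_commute)
  ultimately show ?thesis
    using that z by auto
qed

text \<open>At the largest parameter \<open>s\<close> with the property,
  \<open>infdist_increase_on_sphere\<close> yields a point \<open>z\<close> at distance
  \<open>s + h\<close> from \<open>L\<close>, thus at least that far from \<open>x\<close>. Equality
  in the triangle inequality puts \<open>z\<close> on the ray, which contradicts maximality.\<close>

lemma nearest_point_extends:
  fixes L :: "'a::euclidean_space set"
  assumes L: "closed L" and unique: "unique_nearest L r"
    and x: "x \<in> L" and u: "norm u = 1"
    and t: "0 < t" "infdist (x + t *\<^sub>R u) L = t" and t': "t \<le> t'" "t' < r"
  shows "infdist (x + t' *\<^sub>R u) L = t'"
proof -
  have "L \<noteq> {}" using x by auto
  define S where "S = {t..t'} \<inter> {s. infdist (x + s *\<^sub>R u) L = s}"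
  have "compact S"
    unfolding S_def
    by (intro compact_Int_closed compact_Icc closed_Collect_eq continuous_intros)
  moreover have "t \<in> S" using t t' by (simp add: S_def)
  ultimately obtain s where s: "s \<in> S" and max: "\<And>y. y \<in> S \<Longrightarrow> y \<le> s"
    using compact_attains_sup[of S] by blast
  have "s = t'"
  proof (rule ccontr)
    assume "s \<noteq> t'"
    define p where "p = x + s *\<^sub>R u"
    define h where "h = min (s / 2) (t' - s)"
    have p: "infdist p L = s" "0 < s" "s < t'"
      using s t \<open>s \<noteq> t'\<close> by (auto simp: S_def p_def)
    then have h: "0 < h" "h < s" "s + h \<le> t'"
      by (auto simp: h_def min_def)
    obtain z where z: "dist p z = h" "infdist z L = s + h"
      using infdist_increase_on_sphere[OF L \<open>L \<noteq> {}\<close> unique, of h p] p h t' by auto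
    have "norm (s *\<^sub>R u) = s" "norm (z - p) = h"
      using p u z by (auto simp: dist_norm norm_minus_commute)
    moreover have "norm (s *\<^sub>R u + (z - p)) = s + h"
    proof (rule antisym)
      have *: "s *\<^sub>R u + (z - p) = z - x" by (simp add: p_def)
      show "s + h \<le> norm (s *\<^sub>R u + (z - p))"
        unfolding * using infdist_le[OF x, of z] z by (simp add: dist_norm)
    qed (use calculation norm_triangle_ineq[of "s *\<^sub>R u" "z - p"] in simp)
    ultimately have "s *\<^sub>R (z - p) = h *\<^sub>R s *\<^sub>R u"
      using norm_triangle_eq[of "s *\<^sub>R u" "z - p"] by simp
    then have "z - p = h *\<^sub>R u"
      using p(2) by (metis less_irrefl scaleR_left_commute scaleR_left_imp_eq)
    then have "z = x + (s + h) *\<^sub>R u" by (simp add: p_def algebra_simps)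
    then have "s + h \<in> S"
      using z h s by (simp add: S_def)
    with max h show False by force
  qed
  with s show ?thesis by (simp add: S_def)
qed

lemma nearest_point_towards:
  fixes L :: "'a::real_normed_vector set"
  assumes x: "x \<in> L" "dist p x = infdist p L" and t: "0 \<le> t" "t \<le> 1"
  shows "dist (p - t *\<^sub>R (p - x)) x = infdist (p - t *\<^sub>R (p - x)) L"
    "dist (p - t *\<^sub>R (p - x)) x = (1 - t) * infdist p L"
proof -
  have "p - t *\<^sub>R (p - x) - x = (1 - t) *\<^sub>R (p - x)" by (simp add: algebra_simps)
  then show *: "dist (p - t *\<^sub>R (p - x)) x = (1 - t) * infdist p L"
    using t x by (simp add: dist_norm)
  have "dist p (p - t *\<^sub>R (p - x)) = t * infdist p L"
    using t x by (simp add: dist_norm)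
  then show "dist (p - t *\<^sub>R (p - x)) x = infdist (p - t *\<^sub>R (p - x)) L"
    using infdist_le[OF x(1), of "p - t *\<^sub>R (p - x)"] infdist_dist_le[of p L "p - t *\<^sub>R (p - x)"] *
    by (simp add: algebra_simps)
qed

text \<open>
  The nearest point projection maps the segment between \<open>p - t (p - x)\<close> and \<open>p - t (p - y)\<close> to a
  connected set joining \<open>x\<close> to \<open>y\<close>; for \<open>t\<close> tending to 0, its points accumulate at nearest points
  of \<open>p\<close>, so that \<open>x\<close> would not be isolated among those.
\<close>

lemma isolated_nearest_points_antipodal:
  fixes L :: "'a::euclidean_space set"
  assumes L: "closed L" and unique: "unique_nearest L r" and r: "0 < r" "infdist p L = r"
    and x: "x \<in> L" "dist p x = r" and y: "y \<in> L" "dist p y = r" and "x \<noteq> y"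
    and isolated: "0 < \<epsilon>" "\<And>q. q \<in> L \<Longrightarrow> dist p q = r \<Longrightarrow> dist q x < \<epsilon> \<Longrightarrow> q = x"
  shows "p - x = - (p - y)"
proof (rule ccontr)
  assume not_antipodal: "p - x \<noteq> - (p - y)"
  define u v where "u = p - x" and "v = p - y"
  have L_ne: "L \<noteq> {}" using x by auto
  have uv: "norm u = r" "norm v = r" "u + v \<noteq> 0"
    using x y not_antipodal eq_neg_iff_add_eq_0[of u v] by (simp_all add: u_def v_def dist_norm)
  \<comment> \<open>The mean of \<open>u \<bullet> u\<close> and \<open>u \<bullet> v\<close>, a
    quarter of the squared norm of \<open>u + v\<close>: it is positive as \<open>u\<close> and
    \<open>v\<close> are not opposite. Each \<open>w\<close> between \<open>u\<close> and
    \<open>v\<close> has \<open>u \<bullet> w + v \<bullet> w = 2 * m\<close>, so one summand is at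
    least \<open>m\<close>.\<close>
  define m where "m = (r\<^sup>2 + u \<bullet> v) / 2"
  have "u \<bullet> u = r\<^sup>2" "v \<bullet> v = r\<^sup>2"
    using uv by (simp_all add: dot_square_norm)
  then have "(norm (u + v))\<^sup>2 = 4 * m"
    unfolding m_def power2_norm_eq_inner
    by (simp add: inner_add_left inner_add_right inner_commute[of v u])
  then have "0 < m" using uv(3) by (metis zero_less_norm_iff zero_less_power zero_less_mult_pos zero_less_numeral)
  define \<pi> where "\<pi> z = (SOME q. q \<in> L \<and> dist z q = infdist z L)" for z
  have \<pi>: "\<pi> z \<in> L" "dist z (\<pi> z) = infdist z L" for z
    using someI_ex[of "\<lambda>q. q \<in> L \<and> dist z q = infdist z L"] nearest_point_exists[OF L L_ne, of z]
    unfolding \<pi>_def by blast+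
  have \<pi>_eq: "q = \<pi> z" if "infdist z L < r" "q \<in> L" "dist z q = infdist z L" for z q
    using unique_nearestD[OF unique that(1)] that \<pi> by blast
  have \<pi>_cont: "continuous_on {z. infdist z L < r} \<pi>"
    unfolding continuous_on_iff
  proof (intro ballI allI impI)
    fix z and \<eta> :: real assume "z \<in> {z. infdist z L < r}" "0 < \<eta>"
    then obtain d where "0 < d"
      "\<And>p' q'. dist z p' < d \<Longrightarrow> q' \<in> L \<Longrightarrow> dist p' q' = infdist p' L \<Longrightarrow> dist q' (\<pi> z) < \<eta>"
      using nearest_point_continuous[OF L \<pi>(1)[of z], of z \<eta>] \<pi>_eq[of z] by (metis mem_Collect_eq)
    with \<pi> show "\<exists>d>0. \<forall>x'\<in>{z. infdist z L < r}. dist x' z < d \<longrightarrow> dist (\<pi> x') (\<pi> z) < \<eta>"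
      by (metis dist_commute)
  qed
  \<comment> \<open>Below \<open>\<epsilon>\<close>, so that the sphere around \<open>x\<close>
    contains no nearest point of \<open>p\<close>; at most \<open>dist x y\<close>, so that a
    connected set joining \<open>x\<close> to \<open>y\<close> meets it.\<close>
  define s where "s = min (\<epsilon> / 2) (dist x y)"
  have s: "0 < s" "s < \<epsilon>" "s \<le> dist x y"
    using \<open>0 < \<epsilon>\<close> \<open>x \<noteq> y\<close> by (auto simp: s_def min_def)
  \<comment> \<open>The third condition on \<open>t\<close> puts the whole segment at distance less
    than \<open>r\<close> from \<open>L\<close>, where the projection is continuous: the squared
    distance to \<open>x\<close> or to \<open>y\<close> is at most
    \<open>r^2 - t * (2 * m - t * r^2)\<close>.\<close>
  have sphere: "\<exists>q\<in>L \<inter> sphere x s. dist p q \<le> r + t * r" if t: "0 < t" "t < 1" "t * r\<^sup>2 < 2 * m" for t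
  proof -
    define S where "S = closed_segment (p - t *\<^sub>R u) (p - t *\<^sub>R v)"
    have near: "dist p z \<le> t * r" "infdist z L < r" if "z \<in> S" for z
    proof -
      from that obtain l where l: "0 \<le> l" "l \<le> 1"
        "z = (1 - l) *\<^sub>R (p - t *\<^sub>R u) + l *\<^sub>R (p - t *\<^sub>R v)"
        by (auto simp: S_def in_segment)
      define w where "w = (1 - l) *\<^sub>R u + l *\<^sub>R v"
      have z: "z = p - t *\<^sub>R w" using l by (simp add: w_def algebra_simps)
      have "norm w \<le> (1 - l) * r + l * r"
        unfolding w_def using l uv norm_triangle_ineq[of "(1 - l) *\<^sub>R u" "l *\<^sub>R v"] by simp
      then have w: "norm w \<le> r" by (simp add: algebra_simps)
      then show "dist p z \<le> t * r"
        using t by (simp add: z dist_norm)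
      have closer: "infdist z L < r" if a: "a \<in> L" "norm (p - a) = r" "m \<le> (p - a) \<bullet> w" for a
      proof -
        have "z - a = (p - a) - t *\<^sub>R w" by (simp add: z)
        moreover have "(b - t *\<^sub>R w) \<bullet> (b - t *\<^sub>R w) = b \<bullet> b - 2 * t * (b \<bullet> w) + t\<^sup>2 * (w \<bullet> w)" for b
          by (simp add: inner_commute[of w b] power2_eq_square algebra_simps)
        ultimately have "(norm (z - a))\<^sup>2 = r\<^sup>2 - 2 * t * ((p - a) \<bullet> w) + t\<^sup>2 * (norm w)\<^sup>2"
          by (simp only: dot_square_norm[symmetric] a(2)[symmetric])
        also have "\<dots> \<le> r\<^sup>2 - 2 * t * m + t\<^sup>2 * r\<^sup>2"
          using a(3) t w r(1) by (intro add_mono diff_mono mult_left_mono power_mono) auto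
        also have "\<dots> = r\<^sup>2 - t * (2 * m - t * r\<^sup>2)"
          by (simp add: power2_eq_square algebra_simps)
        also have "\<dots> < r\<^sup>2" using t by simp
        finally have "norm (z - a) < r"
          by (rule power2_less_imp_less) (use r in simp)
        then show ?thesis
          using infdist_le[OF a(1), of z] by (simp add: dist_norm)
      qed
      have "u \<bullet> w + v \<bullet> w = 2 * m"
        unfolding w_def m_def
        using \<open>u \<bullet> u = r\<^sup>2\<close> \<open>v \<bullet> v = r\<^sup>2\<close>
        by (simp add: inner_commute[of v u] algebra_simps)
      then have "m \<le> u \<bullet> w \<or> m \<le> v \<bullet> w" by linarith
      then show "infdist z L < r"
        using closer[of x] closer[of y] x y by (auto simp: u_def v_def dist_norm)
    qed
    have mem: "p - t *\<^sub>R u \<in> S" "p - t *\<^sub>R v \<in> S"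
      by (auto simp: S_def)
    have "dist (p - t *\<^sub>R u) x = infdist (p - t *\<^sub>R u) L"
      "dist (p - t *\<^sub>R v) y = infdist (p - t *\<^sub>R v) L"
      using nearest_point_towards[of x L p t] nearest_point_towards[of y L p t] t x y r
      by (auto simp: u_def v_def)
    with mem have ends: "\<pi> (p - t *\<^sub>R u) = x" "\<pi> (p - t *\<^sub>R v) = y"
      using \<pi>_eq near(2) x(1) y(1) by metis+
    have "continuous_on S (\<lambda>z. dist x (\<pi> z))"
      using near by (intro continuous_intros continuous_on_subset[OF \<pi>_cont]) auto
    then have "connected ((\<lambda>z. dist x (\<pi> z)) ` S)"
      by (rule connected_continuous_image) (simp add: S_def)
    moreover have "dist x x \<in> (\<lambda>z. dist x (\<pi> z)) ` S"
      by (rule image_eqI[OF _ mem(1)]) (simp add: ends)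
    moreover have "dist x y \<in> (\<lambda>z. dist x (\<pi> z)) ` S"
      by (rule image_eqI[OF _ mem(2)]) (simp add: ends)
    ultimately have "s \<in> (\<lambda>z. dist x (\<pi> z)) ` S"
      by (rule connectedD_interval) (use s in auto)
    then obtain z where z: "z \<in> S" "dist x (\<pi> z) = s" by auto
    have "dist p (\<pi> z) \<le> t * r + r"
      using dist_triangle[of p "\<pi> z" z] near[OF z(1)] \<pi>(2)[of z] by simp
    with z \<pi>(1)[of z] show ?thesis by (intro bexI[of _ "\<pi> z"]) auto
  qed
  obtain t0 where t0: "0 < t0" "t0 < 1" "t0 * r\<^sup>2 < 2 * m"
  proof (rule that)
    show "0 < min (1/2) (m / r\<^sup>2)" "min (1/2) (m / r\<^sup>2) < 1"
      using r \<open>0 < m\<close> by auto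
    have "min (1/2) (m / r\<^sup>2) * r\<^sup>2 \<le> m / r\<^sup>2 * r\<^sup>2"
      by (intro mult_right_mono) auto
    then show "min (1/2) (m / r\<^sup>2) * r\<^sup>2 < 2 * m"
      using r \<open>0 < m\<close> by simp
  qed
  \<comment> \<open>The passage \<open>t \<rightarrow> 0\<close> is replaced by a minimum of
    \<open>dist p\<close> over this compact set; \<open>t0\<close> shows that the set is
    nonempty.\<close>
  have "compact (L \<inter> sphere x s)" "L \<inter> sphere x s \<noteq> {}"
    using sphere[OF t0] L by (auto simp: closed_Int_compact)
  moreover have "continuous_on (L \<inter> sphere x s) (dist p)"
    by (intro continuous_intros)
  ultimately obtain q where q: "q \<in> L \<inter> sphere x s" and min: "\<And>k. k \<in> L \<inter> sphere x s \<Longrightarrow> dist p q \<le> dist p k"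
    using continuous_attains_inf[of "L \<inter> sphere x s" "dist p"] by blast
  have "dist p q \<le> r"
  proof (rule field_le_epsilon)
    fix c :: real assume "0 < c"
    define t where "t = min t0 (c / r)"
    have "t * r\<^sup>2 \<le> t0 * r\<^sup>2" by (intro mult_right_mono) (auto simp: t_def)
    with t0(3) have "t * r\<^sup>2 < 2 * m" by linarith
    with t0 \<open>0 < c\<close> r have t: "0 < t" "t < 1" "t * r\<^sup>2 < 2 * m"
      by (auto simp: t_def)
    have "t \<le> c / r" by (simp add: t_def)
    then have "t * r \<le> c" using r by (simp add: pos_le_divide_eq)
    moreover obtain k where "k \<in> L \<inter> sphere x s" "dist p k \<le> r + t * r"
      using sphere[OF t] by blast
    ultimately show "dist p q \<le> r + c"
      using min[of k] \<open>t * r \<le> c\<close> by linarith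
  qed
  moreover have "r \<le> dist p q"
    using infdist_le[of q L p] q r by auto
  ultimately have "q = x"
    using isolated(2)[of q] q s by (auto simp: dist_commute)
  with q s show False by auto
qed

section \<open>Components of the curve\<close>

text \<open>Stated for derivatives within the domain and for either order of \<open>a\<close> and
  \<open>b\<close>, to serve arc endpoints as well. The inequalities locate \<open>\<xi>\<close>
  between \<open>a\<close> and \<open>b\<close> without a case distinction.\<close>

lemma MVT_within:
  fixes f f' :: "real \<Rightarrow> real"
  assumes D: "convex D" "a \<in> D" "b \<in> D"
    and f: "\<And>t. t \<in> D \<Longrightarrow> (f has_real_derivative f' t) (at t within D)"
  obtains \<xi> where "\<xi> \<in> D" "\<bar>\<xi> - a\<bar> \<le> \<bar>b - a\<bar>" "\<bar>\<xi> - b\<bar> \<le> \<bar>b - a\<bar>"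
    "0 \<le> (b - a) * (\<xi> - a)" "f b - f a = (b - a) * f' \<xi>"
proof -
  have *: "\<exists>\<xi>\<in>{u<..<v}. f v - f u = (v - u) * f' \<xi>" "{u..v} \<subseteq> D" if "u < v" "u \<in> D" "v \<in> D" for u v
  proof -
    show sub: "{u..v} \<subseteq> D"
      using D(1) that closed_segment_subset[of u D v] by (simp add: closed_segment_eq_real_ivl)
    have "(f has_derivative (\<lambda>h. h * f' x)) (at x within {u..v})" if "x \<in> {u..v}" for x
    proof -
      have "(f has_real_derivative f' x) (at x within {u..v})"
        using f that sub by (blast intro: has_field_derivative_subset)
      then show ?thesis
        by (simp add: has_field_derivative_def mult_commute_abs)
    qed
    then have "\<exists>x\<in>{u<..<v}. f v - f u = (v - u) * f' x"
      by (intro mvt_simple[OF \<open>u < v\<close>]) auto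
    then show "\<exists>\<xi>\<in>{u<..<v}. f v - f u = (v - u) * f' \<xi>" by blast
  qed
  consider "a = b" | "a < b" | "b < a" by linarith
  then show ?thesis
  proof cases
    case 1
    then show ?thesis using that[of a] D by simp
  next
    case 2
    with *[of a b] D obtain \<xi> where "\<xi> \<in> {a<..<b}" "f b - f a = (b - a) * f' \<xi>" "{a..b} \<subseteq> D" by blast
    moreover from this have "\<xi> \<in> D" "\<bar>\<xi> - a\<bar> \<le> \<bar>b - a\<bar>" "\<bar>\<xi> - b\<bar> \<le> \<bar>b - a\<bar>"
      "0 \<le> (b - a) * (\<xi> - a)"
      by auto
    ultimately show ?thesis using that by blast
  next
    case 3
    with *[of b a] D obtain \<xi> where \<xi>: "\<xi> \<in> {b<..<a}" "f a - f b = (a - b) * f' \<xi>" "{b..a} \<subseteq> D" by blast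
    then have "f b - f a = (b - a) * f' \<xi>" by (simp add: algebra_simps)
    moreover from \<xi> have "\<xi> \<in> D" "\<bar>\<xi> - a\<bar> \<le> \<bar>b - a\<bar>" "\<bar>\<xi> - b\<bar> \<le> \<bar>b - a\<bar>"
      "0 \<le> (b - a) * (\<xi> - a)"
      by (auto intro: mult_nonpos_nonpos)
    ultimately show ?thesis using that by blast
  qed
qed

text \<open>The parameter shifts that fix every point. With the trivial shift for arcs, both kinds
  of component are treated alike.\<close>

fun periods :: "component \<Rightarrow> real set" where
  "periods (Arc l \<gamma>) = {0}"
| "periods (Circle l \<gamma>) = range (\<lambda>n::int. of_int n * l)"

lemma periods_add: "\<sigma> \<in> periods C \<Longrightarrow> \<tau> \<in> periods C \<Longrightarrow> \<sigma> + \<tau> \<in> periods C"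
proof (cases C)
  case (Circle l \<gamma>)
  then show "\<sigma> \<in> periods C \<Longrightarrow> \<tau> \<in> periods C \<Longrightarrow> \<sigma> + \<tau> \<in> periods C"
    by (auto simp: distrib_right[symmetric] simp flip: of_int_add)
qed simp

lemma convex_comp_dom: "convex (comp_dom C)"
  by (cases C) auto

lemma comp_dom_add_period: "s \<in> comp_dom C \<Longrightarrow> \<tau> \<in> periods C \<Longrightarrow> s + \<tau> \<in> comp_dom C"
  by (cases C) auto

lemma fundamental_interval_subset: "{0..comp_length C} \<subseteq> comp_dom C"
  by (cases C) auto

context
  fixes C :: component
  assumes C: "c11_component C"
begin

lemma comp_length_pos: "0 < comp_length C"
  using C by (simp add: c11_component_def)

lemma point_has_derivative:
  "s \<in> comp_dom C \<Longrightarrow>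
    (comp_point C has_vector_derivative comp_tangent C s) (at s within comp_dom C)"
  using C by (simp add: c11_component_def comp_tangent_def vector_derivative_works)

lemma norm_tangent: "s \<in> comp_dom C \<Longrightarrow> norm (comp_tangent C s) = 1"
  using C by (simp add: c11_component_def)

lemma continuous_on_point: "continuous_on (comp_dom C) (comp_point C)"
  by (intro differentiable_imp_continuous_on)
    (auto simp: differentiable_on_def intro: differentiableI_vector point_has_derivative)

lemma continuous_on_tangent: "continuous_on (comp_dom C) (comp_tangent C)"
  using C lipschitz_on_continuous_on unfolding c11_component_def by blast

lemma point_add_period:
  "\<tau> \<in> periods C \<Longrightarrow> comp_point C (s + \<tau>) = comp_point C s"
proof (cases C)
  case (Circle l \<gamma>)
  with C have "\<gamma> s = \<gamma> (s + of_int n * l)" for n :: int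
    by (simp add: c11_component_def)
  with Circle show "\<tau> \<in> periods C \<Longrightarrow> comp_point C (s + \<tau>) = comp_point C s"
    by auto
qed simp

lemma tangent_add_period:
  assumes s: "s \<in> comp_dom C" and \<tau>: "\<tau> \<in> periods C"
  shows "comp_tangent C (s + \<tau>) = comp_tangent C s"
proof (cases C)
  case (Circle l \<gamma>)
  then have "(comp_point C has_vector_derivative comp_tangent C (s + \<tau>)) (at (s + \<tau>))"
    "(comp_point C has_vector_derivative comp_tangent C s) (at s)"
    using point_has_derivative[of "s + \<tau>"] point_has_derivative[of s] by simp_all
  moreover have "((\<lambda>t. t + \<tau>) has_vector_derivative 1) (at s)"
    by (auto intro!: derivative_eq_intros)
  ultimately have "((comp_point C \<circ> (\<lambda>t. t + \<tau>)) has_vector_derivative 1 *\<^sub>R comp_tangent C (s + \<tau>)) (at s)"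
    by (intro vector_diff_chain_at) auto
  moreover have "comp_point C \<circ> (\<lambda>t. t + \<tau>) = comp_point C"
    using point_add_period[OF \<tau>] by auto
  ultimately show ?thesis
    using \<open>(comp_point C has_vector_derivative comp_tangent C s) (at s)\<close>
    by (metis scaleR_one vector_derivative_at)
qed (use \<tau> in simp)

lemma same_point_period:
  assumes "s \<in> comp_dom C" "t \<in> comp_dom C" "comp_point C s = comp_point C t"
  obtains \<tau> where "\<tau> \<in> periods C" "t = s + \<tau>"
proof (cases C)
  case (Arc l \<gamma>)
  with assms C have "s = t" by (auto simp: c11_component_def dest: inj_onD)
  then show ?thesis using that[of 0] Arc by simp
next
  case (Circle l \<gamma>)
  with assms C obtain n :: int where "t - s = of_int n * l"
    by (auto simp: c11_component_def)
  then show ?thesis using that[of "t - s"] Circle by auto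
qed

lemma fundamental_parameter:
  assumes "s \<in> comp_dom C"
  obtains s0 \<tau> where "s0 \<in> {0..comp_length C}" "\<tau> \<in> periods C" "s = s0 + \<tau>"
proof (cases C)
  case (Arc l \<gamma>)
  then show ?thesis using that[of s 0] assms by simp
next
  case (Circle l \<gamma>)
  define n where "n = \<lfloor>s / l\<rfloor>"
  have "0 < l" using comp_length_pos Circle by simp
  then have "of_int n * l \<le> s" "s \<le> (of_int n + 1) * l"
    by (auto simp: n_def pos_le_divide_eq[symmetric] pos_divide_le_eq[symmetric])
  then show ?thesis
    using that[of "s - of_int n * l" "of_int n * l"] Circle by (auto simp: algebra_simps)
qed

lemma comp_image_fundamental: "comp_image C = comp_point C ` {0..comp_length C}"
proof
  show "comp_image C \<subseteq> comp_point C ` {0..comp_length C}"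
  proof
    fix x assume "x \<in> comp_image C"
    then obtain s where s: "s \<in> comp_dom C" "x = comp_point C s"
      by (auto simp: comp_image_def)
    then obtain s0 \<tau> where "s0 \<in> {0..comp_length C}" "\<tau> \<in> periods C" "s = s0 + \<tau>"
      using fundamental_parameter by blast
    with s show "x \<in> comp_point C ` {0..comp_length C}"
      by (auto simp: point_add_period)
  qed
  show "comp_point C ` {0..comp_length C} \<subseteq> comp_image C"
    unfolding comp_image_def using fundamental_interval_subset by blast
qed

lemma compact_comp_image: "compact (comp_image C)"
  unfolding comp_image_fundamental
  using continuous_on_subset[OF continuous_on_point fundamental_interval_subset]
  by (intro compact_continuous_image) auto

text \<open>A uniformly continuous inverse of the parametrization, modulo periods. Embeddedness
  makes the distance positive on the compact set of parameter pairs that are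
  \<open>\<eta>\<close>-apart, so it has a positive lower bound there.\<close>

lemma nearby_parameter_component:
  assumes "0 < \<eta>"
  obtains \<epsilon> where "0 < \<epsilon>"
    "\<And>s y. s \<in> comp_dom C \<Longrightarrow> y \<in> comp_image C \<Longrightarrow> dist (comp_point C s) y < \<epsilon> \<Longrightarrow>
      \<exists>t\<in>comp_dom C. \<bar>t - s\<bar> < \<eta> \<and> comp_point C t = y"
proof -
  define I where "I = {0..comp_length C}"
  \<comment> \<open>Being \<open>\<eta>\<close>-apart must hold for all periods at once, since
    parameters near opposite ends of the fundamental interval of a circle give close points.\<close>
  define K where "K = (I \<times> I) \<inter> (\<Inter>\<tau>\<in>periods C. {z. \<eta> \<le> \<bar>snd z + \<tau> - fst z\<bar>})"
  define \<delta> where "\<delta> z = dist (comp_point C (fst z)) (comp_point C (snd z))" for z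
  have "compact K"
    unfolding K_def I_def
    by (intro compact_Int_closed compact_Times compact_Icc closed_INT ballI closed_Collect_le
        continuous_intros)
  moreover have cont: "continuous_on K \<delta>"
    unfolding \<delta>_def
    by (intro continuous_intros continuous_on_compose2[OF continuous_on_point])
      (use fundamental_interval_subset[of C] in \<open>auto simp: K_def I_def\<close>)
  moreover have pos: "0 < \<delta> z" if "z \<in> K" for z
  proof (rule ccontr)
    assume "\<not> 0 < \<delta> z"
    then have "comp_point C (snd z) = comp_point C (fst z)" by (simp add: \<delta>_def)
    moreover have "fst z \<in> comp_dom C" "snd z \<in> comp_dom C"
      using that fundamental_interval_subset[of C] by (auto simp: K_def I_def)
    ultimately obtain \<tau> where "\<tau> \<in> periods C" "fst z = snd z + \<tau>"
      using same_point_period by blast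
    with that \<open>0 < \<eta>\<close> show False by (auto simp: K_def)
  qed
  ultimately obtain \<epsilon> where \<epsilon>: "0 < \<epsilon>" "\<And>z. z \<in> K \<Longrightarrow> \<epsilon> \<le> \<delta> z"
  proof (cases "K = {}")
    case False
    with \<open>compact K\<close> cont obtain z where "z \<in> K" "\<And>y. y \<in> K \<Longrightarrow> \<delta> z \<le> \<delta> y"
      using continuous_attains_inf[of K \<delta>] by blast
    then show ?thesis using that[of "\<delta> z"] pos by blast
  qed (use that[of 1] in auto)
  show ?thesis
  proof (rule that[OF \<epsilon>(1)])
    fix s y assume s: "s \<in> comp_dom C" and y: "y \<in> comp_image C" "dist (comp_point C s) y < \<epsilon>"
    obtain s0 \<sigma> where s0: "s0 \<in> I" "\<sigma> \<in> periods C" "s = s0 + \<sigma>"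
      using fundamental_parameter[OF s] unfolding I_def by blast
    obtain t0 where t0: "t0 \<in> I" "y = comp_point C t0"
      using y(1) by (auto simp: comp_image_fundamental I_def)
    have "\<delta> (s0, t0) < \<epsilon>"
      using y(2) s0 t0 point_add_period by (simp add: \<delta>_def)
    then have "(s0, t0) \<notin> K" using \<epsilon>(2) by fastforce
    then obtain \<tau> where \<tau>: "\<tau> \<in> periods C" "\<bar>t0 + \<tau> - s0\<bar> < \<eta>"
      using s0 t0 by (auto simp: K_def not_le)
    have "\<sigma> + \<tau> \<in> periods C" using \<tau> s0 periods_add by blast
    moreover have "t0 \<in> comp_dom C" using t0 fundamental_interval_subset[of C] by (auto simp: I_def)
    ultimately have "t0 + (\<sigma> + \<tau>) \<in> comp_dom C" "comp_point C (t0 + (\<sigma> + \<tau>)) = y"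
      using t0 comp_dom_add_period point_add_period by auto
    then show "\<exists>t\<in>comp_dom C. \<bar>t - s\<bar> < \<eta> \<and> comp_point C t = y"
      using \<tau> s0 by (intro bexI[of _ "t0 + (\<sigma> + \<tau>)"]) (auto simp: algebra_simps)
  qed
qed

text \<open>
  The derivative of half the squared distance to \<open>p\<close> is strictly increasing along the component
  near points whose distance to \<open>p\<close> is less than \<open>1 / K\<close>.
\<close>

lemma distance_derivative_monotone:
  assumes K: "K-lipschitz_on (comp_dom C) (comp_tangent C)"
    and a: "a \<in> comp_dom C" and b: "b \<in> comp_dom C"
  shows "(b - a)\<^sup>2 * (1 - K * \<bar>b - a\<bar> - K * dist (comp_point C a) p) \<le>
    (b - a) * ((comp_point C b - p) \<bullet> comp_tangent C b - (comp_point C a - p) \<bullet> comp_tangent C a)"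
proof -
  let ?\<gamma> = "comp_point C" and ?T = "comp_tangent C"
  have K0: "0 \<le> K" using K lipschitz_on_nonneg by blast
  have T_diff: "norm (?T u - ?T v) \<le> K * \<bar>u - v\<bar>" if "u \<in> comp_dom C" "v \<in> comp_dom C" for u v
    using lipschitz_onD[OF K that] by (simp add: dist_norm dist_real_def)
  \<comment> \<open>The increment is the sum of a chord term
    \<open>(?\<gamma> b - ?\<gamma> a) \<bullet> ?T b\<close> and a turning term
    \<open>(?\<gamma> a - p) \<bullet> (?T b - ?T a)\<close>. The mean value theorem bounds the
    first from below; the Lipschitz bound controls the second.\<close>
  have "((\<lambda>t. ?\<gamma> t \<bullet> ?T b) has_real_derivative ?T t \<bullet> ?T b) (at t within comp_dom C)"
    if "t \<in> comp_dom C" for t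
    using bounded_linear.has_vector_derivative[OF bounded_linear_inner_left point_has_derivative[OF that]]
    by (simp add: has_real_derivative_iff_has_vector_derivative)
  from MVT_within[OF convex_comp_dom a b this]
  obtain \<xi> where \<xi>: "\<xi> \<in> comp_dom C" "\<bar>\<xi> - b\<bar> \<le> \<bar>b - a\<bar>"
    and mvt: "?\<gamma> b \<bullet> ?T b - ?\<gamma> a \<bullet> ?T b = (b - a) * (?T \<xi> \<bullet> ?T b)" by metis
  have "?T \<xi> \<bullet> ?T b = 1 + (?T \<xi> - ?T b) \<bullet> ?T b"
    using norm_tangent[OF b] by (simp add: inner_diff_left dot_square_norm)
  moreover have "\<bar>(?T \<xi> - ?T b) \<bullet> ?T b\<bar> \<le> K * \<bar>b - a\<bar>"
    using Cauchy_Schwarz_ineq2[of "?T \<xi> - ?T b" "?T b"] norm_tangent[OF b] T_diff[OF \<xi>(1) b]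
      mult_left_mono[OF \<xi>(2) K0] by simp
  ultimately have "1 - K * \<bar>b - a\<bar> \<le> ?T \<xi> \<bullet> ?T b" by linarith
  then have "(b - a)\<^sup>2 * (1 - K * \<bar>b - a\<bar>) \<le> (b - a)\<^sup>2 * (?T \<xi> \<bullet> ?T b)"
    by (intro mult_left_mono) auto
  also have "\<dots> = (b - a) * ((?\<gamma> b - ?\<gamma> a) \<bullet> ?T b)"
    using mvt by (simp add: inner_diff_left power2_eq_square)
  finally have 1: "(b - a)\<^sup>2 * (1 - K * \<bar>b - a\<bar>) \<le> (b - a) * ((?\<gamma> b - ?\<gamma> a) \<bullet> ?T b)" .
  have "\<bar>(?\<gamma> a - p) \<bullet> (?T b - ?T a)\<bar> \<le> dist (?\<gamma> a) p * (K * \<bar>b - a\<bar>)"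
    using Cauchy_Schwarz_ineq2[of "?\<gamma> a - p" "?T b - ?T a"]
      mult_left_mono[OF T_diff[OF b a], of "dist (?\<gamma> a) p"] by (simp add: dist_norm)
  then have "\<bar>(b - a) * ((?\<gamma> a - p) \<bullet> (?T b - ?T a))\<bar> \<le> \<bar>b - a\<bar> * (dist (?\<gamma> a) p * (K * \<bar>b - a\<bar>))"
    unfolding abs_mult by (rule mult_left_mono) simp
  also have "\<dots> = (b - a)\<^sup>2 * (K * dist (?\<gamma> a) p)"
    by (simp add: power2_eq_square mult_ac flip: abs_mult)
  finally have 2: "- ((b - a)\<^sup>2 * (K * dist (?\<gamma> a) p)) \<le> (b - a) * ((?\<gamma> a - p) \<bullet> (?T b - ?T a))"
    by linarith
  have split: "(?\<gamma> b - p) \<bullet> ?T b - (?\<gamma> a - p) \<bullet> ?T a =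
      (?\<gamma> b - ?\<gamma> a) \<bullet> ?T b + (?\<gamma> a - p) \<bullet> (?T b - ?T a)"
    by (simp add: inner_diff_left inner_diff_right)
  have "(b - a)\<^sup>2 * (1 - K * \<bar>b - a\<bar> - K * dist (?\<gamma> a) p) =
      (b - a)\<^sup>2 * (1 - K * \<bar>b - a\<bar>) - (b - a)\<^sup>2 * (K * dist (?\<gamma> a) p)"
    by (rule right_diff_distrib)
  also have "\<dots> \<le> (b - a) * ((?\<gamma> b - ?\<gamma> a) \<bullet> ?T b) + (b - a) * ((?\<gamma> a - p) \<bullet> (?T b - ?T a))"
    using 1 2 by linarith
  finally show ?thesis
    unfolding split distrib_left .
qed

lemma interval_near_parameter:
  assumes s: "s \<in> comp_dom C" and "0 < e"
  obtains a b where "a < b" "{a..b} \<subseteq> comp_dom C" "\<And>t. t \<in> {a..b} \<Longrightarrow> \<bar>t - s\<bar> < e"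
proof (cases C)
  case (Arc l \<gamma>)
  with s comp_length_pos \<open>0 < e\<close> show ?thesis
    by (intro that[of "max 0 (s - e / 2)" "min l (s + e / 2)"]) auto
next
  case (Circle l \<gamma>)
  with \<open>0 < e\<close> show ?thesis
    by (intro that[of s "s + e / 2"]) auto
qed

lemma comp_dom_islimpt:
  assumes "s \<in> comp_dom C"
  shows "at s within comp_dom C \<noteq> bot"
proof -
  obtain a b where "a < b" "{a..b} \<subseteq> comp_dom C"
    using interval_near_parameter[OF assms, of 1] by (metis zero_less_one)
  then have "a \<in> comp_dom C" "b \<in> comp_dom C" "a \<noteq> b" by auto
  then have "comp_dom C \<noteq> {x}" for x by (metis singletonD)
  then show ?thesis
    using connected_imp_perfect[OF convex_connected[OF convex_comp_dom] assms]
    by (simp add: trivial_limit_within)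
qed

lemma tangent_has_derivative:
  "comp_tangent C differentiable (at s within comp_dom C) \<Longrightarrow>
    (comp_tangent C has_vector_derivative comp_curvature C s) (at s within comp_dom C)"
  by (simp add: comp_curvature_def vector_derivative_works)

lemma curvature_eq:
  assumes "s \<in> comp_dom C" "(comp_tangent C has_vector_derivative D) (at s within comp_dom C)"
  shows "comp_curvature C s = D"
  unfolding comp_curvature_def
  using vector_derivative_within[OF comp_dom_islimpt[OF assms(1)] assms(2)] .

lemma curvature_orthogonal:
  assumes s: "s \<in> comp_dom C" and diff: "comp_tangent C differentiable (at s within comp_dom C)"
  shows "comp_curvature C s \<bullet> comp_tangent C s = 0"
proof -
  let ?T = "comp_tangent C"
  have "((\<lambda>t. ?T t \<bullet> ?T t) has_derivative
      (\<lambda>h. ?T s \<bullet> (h *\<^sub>R comp_curvature C s) + (h *\<^sub>R comp_curvature C s) \<bullet> ?T s)) (at s within comp_dom C)"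
    using tangent_has_derivative[OF diff] unfolding has_vector_derivative_def
    by (intro has_derivative_inner)
  then have "((\<lambda>t. ?T t \<bullet> ?T t) has_vector_derivative 2 * (comp_curvature C s \<bullet> ?T s)) (at s within comp_dom C)"
    unfolding has_vector_derivative_def by (simp add: inner_commute algebra_simps)
  moreover have "((\<lambda>t. ?T t \<bullet> ?T t) has_vector_derivative 0) (at s within comp_dom C)"
    by (rule has_vector_derivative_transform[OF s _ has_vector_derivative_const[of 1]])
      (simp add: norm_tangent dot_square_norm)
  ultimately have "2 * (comp_curvature C s \<bullet> ?T s) = 0"
    by (rule vector_derivative_unique_within[OF comp_dom_islimpt[OF s]])
  then show ?thesis by simp
qed

lemma tangent_multiples_nonpos:
  assumes "s \<in> comp_dom C"
  shows "(\<forall>a\<in>tangent_multiples C s. a * c \<le> 0) \<longleftrightarrow> (\<forall>b\<in>comp_dom C. (b - s) * c \<le> 0)"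
proof (cases C)
  case (Arc l \<gamma>)
  have l: "0 < l" "0 \<le> s" "s \<le> l" using comp_length_pos Arc assms by auto
  have *: "(\<forall>a. a * c \<le> 0) \<longleftrightarrow> c = 0" (is "?A1 \<longleftrightarrow> _")
    "(\<forall>a\<ge>0. a * c \<le> 0) \<longleftrightarrow> c \<le> 0" (is "?A2 \<longleftrightarrow> _")
    "(\<forall>a\<le>0. a * c \<le> 0) \<longleftrightarrow> 0 \<le> c" (is "?A3 \<longleftrightarrow> _")
  proof -
    have "?A2 \<Longrightarrow> c \<le> 0" "?A3 \<Longrightarrow> 0 \<le> c" by (force dest: spec[of _ 1] spec[of _ "-1"])+
    moreover have "c \<le> 0 \<Longrightarrow> ?A2" "0 \<le> c \<Longrightarrow> ?A3" by (auto simp: mult_le_0_iff)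
    ultimately show "?A2 \<longleftrightarrow> c \<le> 0" "?A3 \<longleftrightarrow> 0 \<le> c" by blast+
    moreover have "?A1 \<longleftrightarrow> ?A2 \<and> ?A3" using linear by blast
    ultimately show "?A1 \<longleftrightarrow> c = 0" by auto
  qed
  consider "s = 0" | "s = l" | "0 < s" "s < l" using l by linarith
  then show ?thesis
  proof cases
    case 1
    have "(\<forall>b\<in>{0..l}. b * c \<le> 0) \<longleftrightarrow> c \<le> 0"
      using l by (auto simp: mult_le_0_iff dest: bspec[of _ _ l])
    with 1 * Arc show ?thesis by (auto simp: Ball_def)
  next
    case 2
    have "(\<forall>b\<in>{0..l}. (b - l) * c \<le> 0) \<longleftrightarrow> 0 \<le> c"
      using l by (auto simp: mult_le_0_iff dest: bspec[of _ _ 0])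
    with 2 * Arc l show ?thesis by (auto simp: Ball_def)
  next
    case 3
    have "(\<forall>b\<in>{0..l}. (b - s) * c \<le> 0) \<longleftrightarrow> c = 0"
    proof
      assume "\<forall>b\<in>{0..l}. (b - s) * c \<le> 0"
      from bspec[OF this, of 0] bspec[OF this, of l] 3 show "c = 0"
        by (auto simp: mult_le_0_iff zero_le_mult_iff)
    qed simp
    with 3 * Arc show ?thesis by auto
  qed
next
  case (Circle l \<gamma>)
  have "(\<forall>b. (b - s) * c \<le> 0) \<longleftrightarrow> (\<forall>a. a * c \<le> 0)"
  proof (intro iffI allI)
    fix a assume "\<forall>b. (b - s) * c \<le> 0"
    from this[rule_format, of "a + s"] show "a * c \<le> 0" by simp
  qed simp
  with Circle show ?thesis by simp
qed

end

section \<open>Normal vectors and tangent balls\<close>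

text \<open>
  The differences \<open>b - s\<close> generate the cone of tangent multiples at \<open>s\<close>, so that this encodes
  \<open>x + n \<in> N\<^sub>x L\<close> by conditions which are closed in \<open>x\<close>, too.
\<close>

definition normal_at :: "component set \<Rightarrow> real^3 \<Rightarrow> real^3 \<Rightarrow> bool" where
  "normal_at \<Gamma> x n \<longleftrightarrow> (\<forall>C\<in>\<Gamma>. \<forall>s\<in>comp_dom C. comp_point C s = x \<longrightarrow>
     (\<forall>b\<in>comp_dom C. (b - s) * (n \<bullet> comp_tangent C s) \<le> 0))"

lemma normal_atD:
  "normal_at \<Gamma> x n \<Longrightarrow> C \<in> \<Gamma> \<Longrightarrow> s \<in> comp_dom C \<Longrightarrow> comp_point C s = x \<Longrightarrow> b \<in> comp_dom C \<Longrightarrow>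
    (b - s) * (n \<bullet> comp_tangent C s) \<le> 0"
  unfolding normal_at_def by blast

lemma normal_at_scaleR:
  assumes "normal_at \<Gamma> x n" "0 \<le> c"
  shows "normal_at \<Gamma> x (c *\<^sub>R n)"
  unfolding normal_at_def
proof (intro ballI impI)
  fix C s b assume "C \<in> \<Gamma>" "s \<in> comp_dom C" "comp_point C s = x" "b \<in> comp_dom C"
  from normal_atD[OF assms(1) this]
  have "c * ((b - s) * (n \<bullet> comp_tangent C s)) \<le> 0"
    using assms(2) by (simp add: mult_nonneg_nonpos)
  then show "(b - s) * (c *\<^sub>R n \<bullet> comp_tangent C s) \<le> 0"
    by (simp add: mult_ac)
qed

lemma lipschitz_on_max:
  assumes "finite A" "\<And>a. a \<in> A \<Longrightarrow> \<exists>K. K-lipschitz_on (X a) (f a)"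
  obtains K where "\<And>a. a \<in> A \<Longrightarrow> K-lipschitz_on (X a) (f a)"
proof -
  from assms(2) obtain K where K: "\<And>a. a \<in> A \<Longrightarrow> (K a)-lipschitz_on (X a) (f a)" by metis
  have "(\<Sum>a\<in>A. K a)-lipschitz_on (X a) (f a)" if "a \<in> A" for a
    using K that assms(1) lipschitz_on_nonneg
    by (intro lipschitz_on_le[OF K[OF that]] member_le_sum) blast+
  then show ?thesis using that by blast
qed

section \<open>The whole curve: nearby parameters, normal feet and positive reach\<close>

locale c11 =
  fixes \<Gamma> :: "component set" and L :: "(real^3) set"
  assumes curve: "c11_curve \<Gamma> L"
begin

lemma component: "C \<in> \<Gamma> \<Longrightarrow> c11_component C"
  using curve by (simp add: c11_curve_def)

lemma point_in_curve: "C \<in> \<Gamma> \<Longrightarrow> s \<in> comp_dom C \<Longrightarrow> comp_point C s \<in> L"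
  using curve by (auto simp: c11_curve_def comp_image_def)

lemma parameter_exists:
  assumes "x \<in> L"
  obtains C s where "C \<in> \<Gamma>" "s \<in> comp_dom C" "comp_point C s = x"
  using assms curve by (auto simp: c11_curve_def comp_image_def)

lemma compact_curve: "compact L"
  using curve component compact_comp_image by (auto simp: c11_curve_def)

lemma closed_curve: "closed L"
  using compact_curve compact_imp_closed by blast

lemma curve_nonempty: "L \<noteq> {}"
proof -
  obtain C where "C \<in> \<Gamma>" using curve by (auto simp: c11_curve_def)
  moreover have "0 \<in> comp_dom C"
    using fundamental_interval_subset[of C] comp_length_pos[OF component[OF \<open>C \<in> \<Gamma>\<close>]] by auto
  ultimately show ?thesis using point_in_curve by blast
qed

lemma same_component:
  assumes "C \<in> \<Gamma>" "C' \<in> \<Gamma>" "s \<in> comp_dom C" "t \<in> comp_dom C'" "comp_point C s = comp_point C' t"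
  shows "C = C'"
  using assms curve unfolding c11_curve_def disjoint_family_on_def comp_image_def by blast

text \<open>Disjoint compact components have positive distance, so a point close enough to a
  component lies on it.\<close>

lemma nearby_parameter:
  assumes "0 < \<eta>"
  obtains \<epsilon> where "0 < \<epsilon>"
    "\<And>C s y. C \<in> \<Gamma> \<Longrightarrow> s \<in> comp_dom C \<Longrightarrow> y \<in> L \<Longrightarrow> dist (comp_point C s) y < \<epsilon> \<Longrightarrow>
      \<exists>t\<in>comp_dom C. \<bar>t - s\<bar> < \<eta> \<and> comp_point C t = y"
proof -
  have "\<exists>\<epsilon>>0. \<forall>s\<in>comp_dom C. \<forall>y\<in>L. dist (comp_point C s) y < \<epsilon> \<longrightarrow>
      (\<exists>t\<in>comp_dom C. \<bar>t - s\<bar> < \<eta> \<and> comp_point C t = y)" if C: "C \<in> \<Gamma>" for C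
  proof -
    define M where "M = (\<Union>C'\<in>\<Gamma> - {C}. comp_image C')"
    have "compact M"
      unfolding M_def using curve component compact_comp_image
      by (intro compact_UN) (auto simp: c11_curve_def)
    moreover have "comp_image C \<inter> M = {}"
      using curve C unfolding M_def c11_curve_def disjoint_family_on_def by blast
    ultimately obtain d where d: "0 < d" "\<And>x y. x \<in> comp_image C \<Longrightarrow> y \<in> M \<Longrightarrow> d \<le> dist x y"
      using separate_compact_closed[OF compact_comp_image[OF component[OF C]] compact_imp_closed] by metis
    obtain \<epsilon> where \<epsilon>: "0 < \<epsilon>"
      "\<And>s y. s \<in> comp_dom C \<Longrightarrow> y \<in> comp_image C \<Longrightarrow> dist (comp_point C s) y < \<epsilon> \<Longrightarrow>
        \<exists>t\<in>comp_dom C. \<bar>t - s\<bar> < \<eta> \<and> comp_point C t = y"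
      using nearby_parameter_component[OF component[OF C] assms] by metis
    show ?thesis
    proof (intro exI[of _ "min d \<epsilon>"] conjI ballI impI)
      fix s y assume *: "s \<in> comp_dom C" "y \<in> L" "dist (comp_point C s) y < min d \<epsilon>"
      moreover have "comp_point C s \<in> comp_image C" using * by (auto simp: comp_image_def)
      ultimately have "y \<notin> M" using d(2)[of "comp_point C s" y] by auto
      with \<open>y \<in> L\<close> curve have "y \<in> comp_image C" by (auto simp: M_def c11_curve_def)
      with * \<epsilon>(2) show "\<exists>t\<in>comp_dom C. \<bar>t - s\<bar> < \<eta> \<and> comp_point C t = y" by auto
    qed (use d \<epsilon> in auto)
  qed
  then obtain e where e: "\<And>C. C \<in> \<Gamma> \<Longrightarrow> 0 < e C"
    "\<And>C s y. C \<in> \<Gamma> \<Longrightarrow> s \<in> comp_dom C \<Longrightarrow> y \<in> L \<Longrightarrow> dist (comp_point C s) y < e C \<Longrightarrow>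
      \<exists>t\<in>comp_dom C. \<bar>t - s\<bar> < \<eta> \<and> comp_point C t = y"
    by metis
  have fin: "finite (e ` \<Gamma>)" "e ` \<Gamma> \<noteq> {}" using curve by (auto simp: c11_curve_def)
  show ?thesis
  proof (rule that)
    show "0 < Min (e ` \<Gamma>)" using fin e(1) by (simp add: Min_gr_iff)
    fix C s y assume "C \<in> \<Gamma>" "s \<in> comp_dom C" "y \<in> L" "dist (comp_point C s) y < Min (e ` \<Gamma>)"
    moreover have "Min (e ` \<Gamma>) \<le> e C" using fin \<open>C \<in> \<Gamma>\<close> by simp
    ultimately show "\<exists>t\<in>comp_dom C. \<bar>t - s\<bar> < \<eta> \<and> comp_point C t = y"
      using e(2) by (meson less_le_trans)
  qed
qed

lemma lipschitz_tangents:
  obtains K where "\<And>C. C \<in> \<Gamma> \<Longrightarrow> K-lipschitz_on (comp_dom C) (comp_tangent C)"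
proof (rule lipschitz_on_max)
  show "finite \<Gamma>" using curve by (simp add: c11_curve_def)
  show "\<exists>K. K-lipschitz_on (comp_dom C) (comp_tangent C)" if "C \<in> \<Gamma>" for C
    using component[OF that] by (simp add: c11_component_def)
qed (rule that)

lemma mem_normal_cone_iff: "p \<in> normal_cone \<Gamma> x \<longleftrightarrow> normal_at \<Gamma> x (p - x)"
proof -
  have "p \<in> normal_cone \<Gamma> x \<longleftrightarrow> (\<forall>C\<in>\<Gamma>. \<forall>s\<in>comp_dom C. comp_point C s = x \<longrightarrow>
      (\<forall>a\<in>tangent_multiples C s. a * ((p - x) \<bullet> comp_tangent C s) \<le> 0))"
    unfolding normal_cone_def tangent_cone_def by (auto; force)
  also have "\<dots> \<longleftrightarrow> normal_at \<Gamma> x (p - x)"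
    unfolding normal_at_def using tangent_multiples_nonpos[OF component] by (auto simp: Ball_def)
  finally show ?thesis .
qed

text \<open>The first-order condition for a minimum of the squared distance on the parameter domain;
  at arc endpoints only the inward direction can be tested.\<close>

lemma nearest_imp_normal:
  assumes x: "dist p x = infdist p L"
  shows "normal_at \<Gamma> x (p - x)"
  unfolding normal_at_def
proof (intro ballI impI, rule ccontr)
  fix C s b assume C: "C \<in> \<Gamma>" and s: "s \<in> comp_dom C" "comp_point C s = x" and b: "b \<in> comp_dom C"
    and pos: "\<not> (b - s) * ((p - x) \<bullet> comp_tangent C s) \<le> 0"
  define f where "f t = (comp_point C t - p) \<bullet> (comp_point C t - p)" for t
  define f' where "f' = 2 * ((x - p) \<bullet> comp_tangent C s)"
  have "((\<lambda>t. comp_point C t - p) has_vector_derivative comp_tangent C s) (at s within comp_dom C)"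
    using point_has_derivative[OF component[OF C] s(1)] by (auto intro!: derivative_eq_intros)
  then have "((\<lambda>t. comp_point C t - p) has_derivative (\<lambda>h. h *\<^sub>R comp_tangent C s)) (at s within comp_dom C)"
    by (simp add: has_vector_derivative_def)
  from has_derivative_inner[OF this this]
  have deriv: "(f has_real_derivative f') (at s within comp_dom C)"
    unfolding f_def has_field_derivative_def f'_def s(2)
    by (rule has_derivative_eq_rhs) (auto simp: inner_commute algebra_simps)
  have min: "f s \<le> f t" if "t \<in> comp_dom C" for t
  proof -
    have "norm (comp_point C s - p) \<le> norm (comp_point C t - p)"
      using infdist_le[OF point_in_curve[OF C that], of p] x s by (simp add: dist_norm norm_minus_commute)
    then show ?thesis
      by (simp add: f_def dot_square_norm power_mono)
  qed
  have seg: "closed_segment s b \<subseteq> comp_dom C"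
    using closed_segment_subset[OF s(1) b convex_comp_dom] .
  have sign: "(b - s) * f' < 0"
    using pos by (simp add: f'_def inner_diff_left algebra_simps)
  show False
  proof (cases "s < b")
    case True
    with sign have "f' < 0" by (simp add: mult_less_0_iff)
    then obtain d where "0 < d" and d: "\<And>h. 0 < h \<Longrightarrow> s + h \<in> comp_dom C \<Longrightarrow> h < d \<Longrightarrow> f (s + h) < f s"
      using has_real_derivative_neg_dec_right[OF deriv] by blast
    define h where "h = min (d / 2) (b - s)"
    have h: "0 < h" "h < d" using True \<open>0 < d\<close> by (auto simp: h_def)
    have "s + h \<in> comp_dom C"
      using seg True \<open>0 < d\<close> by (auto simp: h_def closed_segment_eq_real_ivl subset_iff)
    from d[OF h(1) this h(2)] min[OF this] show False by simp
  next
    case False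
    with sign have "0 < f'" "b < s" by (auto simp: mult_less_0_iff)
    then obtain d where "0 < d" and d: "\<And>h. 0 < h \<Longrightarrow> s - h \<in> comp_dom C \<Longrightarrow> h < d \<Longrightarrow> f (s - h) < f s"
      using has_real_derivative_pos_inc_left[OF deriv] by blast
    define h where "h = min (d / 2) (s - b)"
    have h: "0 < h" "h < d" using \<open>b < s\<close> \<open>0 < d\<close> by (auto simp: h_def)
    have "s - h \<in> comp_dom C"
      using seg \<open>b < s\<close> \<open>0 < d\<close> by (auto simp: h_def closed_segment_eq_real_ivl subset_iff)
    from d[OF h(1) this h(2)] min[OF this] show False by simp
  qed
qed

text \<open>Normality at both feet bounds the increment of the distance derivative from one side,
  and \<open>distance_derivative_monotone\<close> bounds it from the other; both hold only for equal
  parameters.\<close>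

lemma normal_foot_unique:
  assumes K: "\<And>C. C \<in> \<Gamma> \<Longrightarrow> K-lipschitz_on (comp_dom C) (comp_tangent C)" and m: "K * m < 1"
  obtains \<epsilon> where "0 < \<epsilon>"
    "\<And>p x y. x \<in> L \<Longrightarrow> y \<in> L \<Longrightarrow> normal_at \<Gamma> x (p - x) \<Longrightarrow> normal_at \<Gamma> y (p - y) \<Longrightarrow>
      dist x p \<le> m \<Longrightarrow> dist x y < \<epsilon> \<Longrightarrow> x = y"
proof -
  have K0: "0 \<le> K"
  proof -
    obtain C where "C \<in> \<Gamma>" using curve by (auto simp: c11_curve_def)
    then show ?thesis using K lipschitz_on_nonneg by blast
  qed
  \<comment> \<open>Chosen so that \<open>K * \<eta> < 1 - K * m\<close>; the denominator
    \<open>K + 1\<close> also covers \<open>K = 0\<close>.\<close>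
  define \<eta> where "\<eta> = (1 - K * m) / (K + 1)"
  have \<eta>: "0 < \<eta>" "K * \<eta> < 1 - K * m"
    using m K0 by (auto simp: \<eta>_def field_simps)
  obtain \<epsilon> where "0 < \<epsilon>" and near:
    "\<And>C s y. C \<in> \<Gamma> \<Longrightarrow> s \<in> comp_dom C \<Longrightarrow> y \<in> L \<Longrightarrow> dist (comp_point C s) y < \<epsilon> \<Longrightarrow>
      \<exists>t\<in>comp_dom C. \<bar>t - s\<bar> < \<eta> \<and> comp_point C t = y"
    using nearby_parameter[OF \<eta>(1)] by metis
  show ?thesis
  proof (rule that[OF \<open>0 < \<epsilon>\<close>])
    fix p x y assume *: "x \<in> L" "y \<in> L" "normal_at \<Gamma> x (p - x)" "normal_at \<Gamma> y (p - y)"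
      "dist x p \<le> m" "dist x y < \<epsilon>"
    obtain C s where s: "C \<in> \<Gamma>" "s \<in> comp_dom C" "comp_point C s = x"
      using parameter_exists[OF *(1)] .
    with near * obtain t where t: "t \<in> comp_dom C" "\<bar>t - s\<bar> < \<eta>" "comp_point C t = y" by blast
    let ?T = "comp_tangent C"
    have "K * \<bar>t - s\<bar> \<le> K * \<eta>" "K * dist x p \<le> K * m"
      using K0 t * by (auto intro: mult_left_mono)
    with \<eta>(2) have gap: "0 < 1 - K * \<bar>t - s\<bar> - K * dist x p" by linarith
    \<comment> \<open>Each condition is tested with the parameter of the other foot. This direction
      stays in the domain, so the one-sided condition at an endpoint suffices.\<close>
    have "(t - s) * ((p - x) \<bullet> ?T s) \<le> 0" "(s - t) * ((p - y) \<bullet> ?T t) \<le> 0"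
      using normal_atD[OF *(3) s t(1)] normal_atD[OF *(4) s(1) t(1,3) s(2)] .
    then have "(t - s) * ((y - p) \<bullet> ?T t - (x - p) \<bullet> ?T s) \<le> 0"
      by (simp add: inner_diff_left algebra_simps)
    with distance_derivative_monotone[OF component[OF s(1)] K[OF s(1)] s(2) t(1), of p] s t
    have "(t - s)\<^sup>2 * (1 - K * \<bar>t - s\<bar> - K * dist x p) \<le> 0" by simp
    with gap have "(t - s)\<^sup>2 \<le> 0" by (simp add: mult_le_0_iff)
    then have "t = s" by simp
    with s t show "x = y" by simp
  qed
qed

lemma normal_foot_unique_nearby:
  obtains m \<epsilon> where "0 < m" "0 < \<epsilon>"
    "\<And>p x y. x \<in> L \<Longrightarrow> y \<in> L \<Longrightarrow> normal_at \<Gamma> x (p - x) \<Longrightarrow> normal_at \<Gamma> y (p - y) \<Longrightarrow>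
      dist x p \<le> m \<Longrightarrow> dist x y < \<epsilon> \<Longrightarrow> x = y"
proof -
  obtain K where K: "\<And>C. C \<in> \<Gamma> \<Longrightarrow> K-lipschitz_on (comp_dom C) (comp_tangent C)"
    using lipschitz_tangents by blast
  define m where "m = 1 / (2 * \<bar>K\<bar> + 1)"
  have "0 < m" "K * m < 1" by (auto simp: m_def field_simps)
  with normal_foot_unique[OF K \<open>K * m < 1\<close>] that show ?thesis by metis
qed

text \<open>Nearest points are normal feet, and two of them at distance below
  \<open>\<epsilon> / 2\<close> from \<open>p\<close> are closer than \<open>\<epsilon>\<close> to
  each other.\<close>

lemma positive_reach:
  obtains r where "0 < r" "unique_nearest L r"
proof -
  obtain m \<epsilon> where "0 < m" "0 < \<epsilon>" and unique:
    "\<And>p x y. x \<in> L \<Longrightarrow> y \<in> L \<Longrightarrow> normal_at \<Gamma> x (p - x) \<Longrightarrow> normal_at \<Gamma> y (p - y) \<Longrightarrow>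
      dist x p \<le> m \<Longrightarrow> dist x y < \<epsilon> \<Longrightarrow> x = y"
    using normal_foot_unique_nearby by metis
  show ?thesis
  proof (rule that)
    show "0 < min m (\<epsilon> / 2)" using \<open>0 < m\<close> \<open>0 < \<epsilon>\<close> by simp
    show "unique_nearest L (min m (\<epsilon> / 2))"
      unfolding unique_nearest_def
    proof (intro allI impI ex_ex1I)
      fix p assume p: "infdist p L < min m (\<epsilon> / 2)"
      show "\<exists>q. q \<in> L \<and> dist p q = infdist p L"
        using nearest_point_exists[OF closed_curve curve_nonempty] by blast
      fix x y assume xy: "x \<in> L \<and> dist p x = infdist p L" "y \<in> L \<and> dist p y = infdist p L"
      then have "dist x y < \<epsilon>"
        using p dist_triangle[of x y p] by (simp add: dist_commute)
      with xy p show "x = y"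
        by (intro unique[of x y p]) (auto intro: nearest_imp_normal simp: dist_commute)
    qed
  qed
qed

text \<open>A nearest point of \<open>x + t n\<close> is a normal foot within \<open>2 * t\<close>
  of \<open>x\<close>, hence equals \<open>x\<close> for small \<open>t\<close>. This is the initial
  segment for \<open>nearest_point_extends\<close>.\<close>

lemma normal_point_nearest:
  assumes x: "x \<in> L" and n: "normal_at \<Gamma> x n" "norm n = 1"
  obtains t0 where "0 < t0" "\<And>t. 0 \<le> t \<Longrightarrow> t < t0 \<Longrightarrow> infdist (x + t *\<^sub>R n) L = t"
proof -
  obtain m \<epsilon> where "0 < m" "0 < \<epsilon>" and unique:
    "\<And>p x y. x \<in> L \<Longrightarrow> y \<in> L \<Longrightarrow> normal_at \<Gamma> x (p - x) \<Longrightarrow> normal_at \<Gamma> y (p - y) \<Longrightarrow>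
      dist x p \<le> m \<Longrightarrow> dist x y < \<epsilon> \<Longrightarrow> x = y"
    using normal_foot_unique_nearby by metis
  show ?thesis
  proof (rule that)
    show "0 < min m (\<epsilon> / 2)" using \<open>0 < m\<close> \<open>0 < \<epsilon>\<close> by simp
    fix t assume t: "0 \<le> t" "t < min m (\<epsilon> / 2)"
    let ?p = "x + t *\<^sub>R n"
    have p: "dist ?p x = t" using t n by (simp add: dist_norm)
    obtain q where q: "q \<in> L" "dist ?p q = infdist ?p L"
      using nearest_point_exists[OF closed_curve curve_nonempty] by blast
    have "dist x q < \<epsilon>"
      using dist_triangle[of x q ?p] infdist_le[OF x, of ?p] p q t by (simp add: dist_commute)
    then have "x = q"
      using t p x q n by (intro unique[of x q ?p])
        (auto intro: nearest_imp_normal normal_at_scaleR simp: dist_commute)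
    with p q show "infdist ?p L = t" by simp
  qed
qed

text \<open>The open balls of radius \<open>r\<close> tangent to the curve contain no point of the curve.\<close>

lemma tangent_ball_condition:
  assumes r: "unique_nearest L r" "0 < r" and x: "x \<in> L" and n: "normal_at \<Gamma> x n" "norm n = 1" and y: "y \<in> L"
  shows "2 * r * (n \<bullet> (y - x)) \<le> (norm (y - x))\<^sup>2"
proof (rule ccontr)
  assume neg: "\<not> ?thesis"
  have below: "2 * t * (n \<bullet> (y - x)) \<le> (norm (y - x))\<^sup>2" if t: "0 < t" "t < r" for t
  proof -
    obtain t0 where t0: "0 < t0" "\<And>t. 0 \<le> t \<Longrightarrow> t < t0 \<Longrightarrow> infdist (x + t *\<^sub>R n) L = t"
      using normal_point_nearest[OF x n] by blast
    define t1 where "t1 = min (t0 / 2) t"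
    have t1: "0 < t1" "t1 < t0" "t1 \<le> t" using t0(1) t by (auto simp: t1_def)
    have "infdist (x + t1 *\<^sub>R n) L = t1" using t0(2) t1 by simp
    from nearest_point_extends[OF closed_curve r(1) x n(2) t1(1) this t1(3) t(2)]
    have "infdist (x + t *\<^sub>R n) L = t" .
    then have "t \<le> norm (x + t *\<^sub>R n - y)"
      using infdist_le[OF y, of "x + t *\<^sub>R n"] by (simp add: dist_norm)
    then have "t\<^sup>2 \<le> (norm (x + t *\<^sub>R n - y))\<^sup>2"
      using t by (intro power_mono) auto
    also have "x + t *\<^sub>R n - y = t *\<^sub>R n - (y - x)" by simp
    also have "(norm \<dots>)\<^sup>2 = t\<^sup>2 * (n \<bullet> n) - 2 * t * (n \<bullet> (y - x)) + (norm (y - x))\<^sup>2"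
      unfolding power2_norm_eq_inner inner_diff_left[of "t *\<^sub>R n"] inner_diff_right[of _ "t *\<^sub>R n"]
      by (simp add: inner_commute[of "y - x" n] power2_eq_square)
    finally show ?thesis using n(2) by (simp add: dot_square_norm)
  qed
  define c where "c = n \<bullet> (y - x)"
  have "0 \<le> (norm (y - x))\<^sup>2" by simp
  with neg have "0 < 2 * r * c" unfolding c_def by linarith
  with r(2) have "0 < c" by (simp add: zero_less_mult_iff)
  \<comment> \<open>The ball condition is available only for \<open>t < r\<close>. If it failed at
    \<open>r\<close>, it would fail at this midpoint between \<open>r\<close> and the larger of 0
    and the critical value.\<close>
  define t where "t = (max 0 ((norm (y - x))\<^sup>2 / (2 * c)) + r) / 2"
  have "(norm (y - x))\<^sup>2 / (2 * c) < r"
    using neg \<open>0 < c\<close> by (simp add: c_def field_simps)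
  then have "0 < t" "t < r" "(norm (y - x))\<^sup>2 / (2 * c) < t"
    using r(2) by (auto simp: t_def)
  then have "(norm (y - x))\<^sup>2 < 2 * t * c"
    using \<open>0 < c\<close> by (simp add: field_simps)
  with below[OF \<open>0 < t\<close> \<open>t < r\<close>] show False by (simp add: c_def)
qed

text \<open>A violated inequality is an open condition on the parameter and the vector, for fixed
  \<open>b\<close>. The tangent multiples jump at arc endpoints, whereas \<open>b - s\<close> is
  continuous in \<open>s\<close>.\<close>

lemma normal_at_closed:
  assumes x: "\<And>k. X k \<in> L" "X \<longlonglongrightarrow> x" and n: "\<And>k. normal_at \<Gamma> (X k) (N k)" "N \<longlonglongrightarrow> n"
  shows "normal_at \<Gamma> x n"
  unfolding normal_at_def
proof (intro ballI impI, rule ccontr)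
  fix C s b assume C: "C \<in> \<Gamma>" and s: "s \<in> comp_dom C" "comp_point C s = x" and b: "b \<in> comp_dom C"
    and pos: "\<not> (b - s) * (n \<bullet> comp_tangent C s) \<le> 0"
  define F where "F z = (b - fst z) * (snd z \<bullet> comp_tangent C (fst z))" for z
  have "continuous_on (comp_dom C \<times> UNIV) F"
    unfolding F_def
    by (intro continuous_intros continuous_on_compose2[OF continuous_on_tangent[OF component[OF C]]]) auto
  moreover have "(s, n) \<in> comp_dom C \<times> UNIV" "0 < F (s, n)" using s pos by (auto simp: F_def)
  ultimately obtain d where d: "0 < d"
    "\<And>z. z \<in> comp_dom C \<times> UNIV \<Longrightarrow> dist z (s, n) < d \<Longrightarrow> dist (F z) (F (s, n)) < F (s, n)"
    unfolding continuous_on_iff by metis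
  obtain \<epsilon> where "0 < \<epsilon>" and near:
    "\<And>C s y. C \<in> \<Gamma> \<Longrightarrow> s \<in> comp_dom C \<Longrightarrow> y \<in> L \<Longrightarrow> dist (comp_point C s) y < \<epsilon> \<Longrightarrow>
      \<exists>t\<in>comp_dom C. \<bar>t - s\<bar> < d / 2 \<and> comp_point C t = y"
    using nearby_parameter[of "d / 2"] d(1) by (metis half_gt_zero)
  have "\<forall>\<^sub>F k in sequentially. dist (X k) x < \<epsilon> \<and> dist (N k) n < d / 2"
    using tendstoD[OF x(2) \<open>0 < \<epsilon>\<close>] tendstoD[OF n(2) half_gt_zero[OF d(1)]] by (rule eventually_conj)
  then obtain k where k: "dist (X k) x < \<epsilon>" "dist (N k) n < d / 2"
    by (metis (mono_tags, lifting) eventually_sequentially order_refl)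
  then obtain t where t: "t \<in> comp_dom C" "\<bar>t - s\<bar> < d / 2" "comp_point C t = X k"
    using near[OF C s(1) x(1)[of k]] s(2) by (auto simp: dist_commute)
  have "dist (t, N k) (s, n) \<le> dist t s + dist (N k) n"
    by (simp add: dist_Pair_Pair sqrt_sum_squares_le_sum)
  also have "\<dots> < d" using k t by (simp add: dist_real_def)
  finally have "dist (F (t, N k)) (F (s, n)) < F (s, n)"
    using d(2) t by simp
  then have "0 < F (t, N k)" by (simp add: dist_real_def)
  with normal_atD[OF n(1)[of k] C t(1,3) b] show False by (simp add: F_def)
qed

end

section \<open>Penalized endpoint distance\<close>

lemma base_point_eq: "base_point = fst"
  by (auto simp: fun_eq_iff)

lemma circ_radius_eq: "circ_radius c = 1 / ereal (norm (snd (snd c)))"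
  by (cases c) simp

lemma circ_radius_ge_iff: "0 < a \<Longrightarrow> ereal a \<le> circ_radius c \<longleftrightarrow> a * norm (snd (snd c)) \<le> 1"
  by (auto simp: circ_radius_eq one_ereal_def ereal_divide pos_le_divide_eq)

lemma circ_radius_antimono:
  assumes "norm (snd (snd c)) \<le> norm (snd (snd c'))"
  shows "circ_radius c' \<le> circ_radius c"
proof (cases "snd (snd c) = 0")
  case False
  with assms have "0 < norm (snd (snd c))" "0 < norm (snd (snd c'))"
    by (auto simp del: zero_less_norm_iff intro: less_le_trans simp: zero_less_norm_iff[symmetric])
  with assms show ?thesis
    by (simp add: circ_radius_eq one_ereal_def divide_left_mono)
qed (simp add: circ_radius_eq one_ereal_def ereal_divide)

lemma attains_Inf_circ_radius:
  assumes "compact A" "A \<noteq> {}"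
  shows "attains_Inf circ_radius A"
proof -
  have "continuous_on A (\<lambda>c. norm (snd (snd c)))" by (intro continuous_intros)
  then obtain c where "c \<in> A" "\<And>c'. c' \<in> A \<Longrightarrow> norm (snd (snd c')) \<le> norm (snd (snd c))"
    using continuous_attains_sup[OF assms] by blast
  then have "circ_radius c = (INF c'\<in>A. circ_radius c')"
    by (intro antisym INF_greatest INF_lower circ_radius_antimono)
  with \<open>c \<in> A\<close> show ?thesis by (auto simp: attains_Inf_def)
qed

lemma closed_Circ: "closed Circ"
proof -
  have "Circ = {z. norm (fst (snd z)) = 1} \<inter> {z. snd (snd z) \<bullet> fst (snd z) = 0}"
    by (auto simp: Circ_def)
  also have "closed \<dots>"
    by (intro closed_Int closed_Collect_eq continuous_intros)
  finally show ?thesis .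
qed

text \<open>The multiplied form also covers a vanishing cosine, which would force the positive
  distance to be at most 0.\<close>

lemma pd_star_le_iff:
  "pd_star \<Gamma> x y \<le> ereal c \<longleftrightarrow> x \<noteq> y \<and> dist x y \<le> c * (cos (psi_star \<Gamma> x y))\<^sup>2"
proof (cases "x = y \<or> cos (psi_star \<Gamma> x y) = 0")
  case True
  then show ?thesis by (auto simp: pd_star_def ereal_divide)
next
  case False
  then have "0 < (cos (psi_star \<Gamma> x y))\<^sup>2" by simp
  with False show ?thesis by (simp add: pd_star_def ereal_divide pos_divide_le_eq)
qed

lemma speed_le:
  assumes C: "c11_component C" and s: "s \<in> comp_dom C" and t: "t \<in> comp_dom C"
  shows "norm (comp_point C t - comp_point C s) \<le> \<bar>t - s\<bar>"
proof -
  have "norm (comp_point C t - comp_point C s) \<le> 1 * norm (t - s)"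
  proof (rule differentiable_bound[OF convex_comp_dom _ _ t s])
    fix u assume u: "u \<in> comp_dom C"
    show "(comp_point C has_derivative (\<lambda>h. h *\<^sub>R comp_tangent C u)) (at u within comp_dom C)"
      using point_has_derivative[OF C u] by (simp add: has_vector_derivative_def)
    show "onorm (\<lambda>h. h *\<^sub>R comp_tangent C u) \<le> 1"
      by (rule onorm_bound) (simp_all add: norm_tangent[OF C u])
  qed
  then show ?thesis by simp
qed

context c11
begin

text \<open>By embeddedness, all parameters of a point differ by periods and share one
  tangent.\<close>

lemma point_with_orthogonal_normal:
  assumes C: "C \<in> \<Gamma>" and s: "s \<in> comp_dom C" and n: "n \<bullet> comp_tangent C s = 0"
  shows "normal_at \<Gamma> (comp_point C s) n"
  unfolding normal_at_def
proof (intro ballI impI)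
  fix C' s' b assume C': "C' \<in> \<Gamma>" "s' \<in> comp_dom C'" "comp_point C' s' = comp_point C s"
  then have "C' = C" using same_component C s by metis
  then obtain \<tau> where "\<tau> \<in> periods C" "s' = s + \<tau>"
    using same_point_period[OF component[OF C] s, of s'] C' by metis
  then have "comp_tangent C' s' = comp_tangent C s"
    using tangent_add_period[OF component[OF C] s] \<open>C' = C\<close> by simp
  with n show "(b - s') * (n \<bullet> comp_tangent C' s') \<le> 0" by simp
qed

text \<open>A vector orthogonal to the tangent stays normal when its sign changes. The sign
  condition is the source of \<open>0 \<le> cos (psi_star \<Gamma> x y)\<close>.\<close>

lemma unit_normal_exists:
  assumes "x \<in> L"
  obtains n where "norm n = 1" "normal_at \<Gamma> x n" "0 \<le> n \<bullet> v"
proof -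
  obtain C s where s: "C \<in> \<Gamma>" "s \<in> comp_dom C" "comp_point C s = x"
    using parameter_exists[OF assms] .
  obtain w where w: "w \<noteq> 0" "comp_tangent C s \<bullet> w = 0"
    using orthogonal_to_vector_exists[of "comp_tangent C s"] by (auto simp: orthogonal_def)
  define n where "n = (if 0 \<le> w \<bullet> v then sgn w else - sgn w)"
  have "norm n = 1" using w by (simp add: n_def norm_sgn)
  moreover have "n \<bullet> comp_tangent C s = 0"
    using w by (simp add: n_def sgn_div_norm inner_commute)
  then have "normal_at \<Gamma> x n" using point_with_orthogonal_normal s by metis
  moreover have "0 \<le> n \<bullet> v"
    by (auto simp: n_def sgn_div_norm mult_le_0_iff)
  ultimately show ?thesis by (rule that)
qed

lemma compact_unit_normals:
  assumes "x \<in> L"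
  shows "compact {n. norm n = 1 \<and> normal_at \<Gamma> x n}" (is "compact ?S")
proof -
  have "closed ?S"
    unfolding closed_sequential_limits
  proof (intro allI impI, elim conjE)
    fix N n assume N: "\<forall>k. N k \<in> ?S" "N \<longlonglongrightarrow> n"
    then have "normal_at \<Gamma> x n"
      using normal_at_closed[of "\<lambda>_. x" x N n] assms by auto
    moreover have "(\<lambda>k. norm (N k)) \<longlonglongrightarrow> norm n" using N(2) by (rule tendsto_norm)
    then have "norm n = 1"
      using N(1) by (simp add: LIMSEQ_const_iff)
    ultimately show "n \<in> ?S" by simp
  qed
  moreover have "bounded ?S" by (rule boundedI[of _ 1]) auto
  ultimately show ?thesis by (simp add: compact_eq_bounded_closed)
qed

text \<open>Since \<open>arccos\<close> is decreasing, the least angle belongs to the greatest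
  cosine, which is attained on the compact set of unit normals.\<close>

lemma cos_psi_star:
  assumes x: "x \<in> L" and "x \<noteq> y"
  obtains n where "norm n = 1" "normal_at \<Gamma> x n"
    "cos (psi_star \<Gamma> x y) = n \<bullet> (y - x) / dist x y" "0 \<le> cos (psi_star \<Gamma> x y)"
    "\<And>n'. norm n' = 1 \<Longrightarrow> normal_at \<Gamma> x n' \<Longrightarrow> n' \<bullet> (y - x) / dist x y \<le> cos (psi_star \<Gamma> x y)"
proof -
  let ?S = "{n. norm n = 1 \<and> normal_at \<Gamma> x n}"
  have d: "0 < dist x y" using \<open>x \<noteq> y\<close> by simp
  have "continuous_on ?S (\<lambda>n. n \<bullet> (y - x))" by (intro continuous_intros)
  moreover obtain m where m: "m \<in> ?S" "0 \<le> m \<bullet> (y - x)"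
    using unit_normal_exists[OF x] by blast
  ultimately obtain n where n: "n \<in> ?S" and max: "\<And>n'. n' \<in> ?S \<Longrightarrow> n' \<bullet> (y - x) \<le> n \<bullet> (y - x)"
    using continuous_attains_sup[OF compact_unit_normals[OF x]] by blast
  define c where "c n = n \<bullet> (y - x) / dist x y" for n
  have c_bound: "\<bar>c n'\<bar> \<le> 1" if "norm n' = 1" for n'
    using Cauchy_Schwarz_ineq2[of n' "y - x"] that d
    by (simp add: c_def dist_norm norm_minus_commute)
  have c_max: "c n' \<le> c n" if "n' \<in> ?S" for n'
    using max[OF that] d by (simp add: c_def divide_right_mono)
  have c_nonneg: "0 \<le> c n"
    using max[OF m(1)] m(2) d by (simp add: c_def)
  have angle: "vec_angle (p - x) (y - x) = arccos (c (sgn (p - x)))" for p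
    by (simp add: vec_angle_def c_def sgn_div_norm dist_norm norm_minus_commute divide_simps)
  have "psi_star \<Gamma> x y = arccos (c n)"
    unfolding psi_star_def
  proof (rule cInf_eq_minimum)
    have "x + n \<in> normal_cone \<Gamma> x - {x}"
      using n by (auto simp: mem_normal_cone_iff)
    moreover have "vec_angle (x + n - x) (y - x) = arccos (c n)"
      using n by (subst angle) (simp add: sgn_div_norm)
    ultimately show "arccos (c n) \<in> (\<lambda>p. vec_angle (p - x) (y - x)) ` (normal_cone \<Gamma> x - {x})"
      by (metis image_eqI)
    fix a assume "a \<in> (\<lambda>p. vec_angle (p - x) (y - x)) ` (normal_cone \<Gamma> x - {x})"
    then obtain p where "p \<in> normal_cone \<Gamma> x - {x}" "a = vec_angle (p - x) (y - x)"
      by blast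
    then have p: "normal_at \<Gamma> x (p - x)" "p \<noteq> x" "a = arccos (c (sgn (p - x)))"
      by (simp_all add: mem_normal_cone_iff angle)
    then have "sgn (p - x) \<in> ?S"
      using normal_at_scaleR[of \<Gamma> x "p - x" "inverse (norm (p - x))"]
      by (simp add: norm_sgn sgn_div_norm)
    then show "arccos (c n) \<le> a"
      unfolding p(3) using c_max c_bound n
      by (intro arccos_le_arccos) (auto simp: abs_le_iff)
  qed
  then have "cos (psi_star \<Gamma> x y) = c n"
    using c_nonneg c_bound[of n] n by (simp add: cos_arccos_abs)
  with n c_nonneg c_max that[of n] show ?thesis by (auto simp: c_def)
qed

lemma cos_psi_star_le:
  assumes r: "unique_nearest L r" "0 < r" and x: "x \<in> L" and y: "y \<in> L" and "x \<noteq> y"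
  shows "2 * r * cos (psi_star \<Gamma> x y) \<le> dist x y"
proof -
  obtain n where n: "norm n = 1" "normal_at \<Gamma> x n"
    "cos (psi_star \<Gamma> x y) = n \<bullet> (y - x) / dist x y"
    using cos_psi_star[OF x \<open>x \<noteq> y\<close>] .
  have "2 * r * (n \<bullet> (y - x)) \<le> dist x y * dist x y"
    using tangent_ball_condition[OF r x n(2,1) y]
    by (simp add: dist_norm norm_minus_commute power2_eq_square)
  then show ?thesis
    using \<open>x \<noteq> y\<close> by (simp add: n(3) pos_divide_le_eq)
qed

lemma pd_star_ge:
  assumes r: "unique_nearest L r" "0 < r" and x: "x \<in> L" and y: "y \<in> L"
  shows "ereal (2 * r) \<le> pd_star \<Gamma> x y"
proof (rule ccontr)
  assume "\<not> ?thesis"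
  then obtain c where c: "pd_star \<Gamma> x y < ereal c" "ereal c < ereal (2 * r)"
    using ereal_dense2[of "pd_star \<Gamma> x y" "ereal (2 * r)"] by (auto simp: not_le)
  let ?q = "cos (psi_star \<Gamma> x y)"
  have "x \<noteq> y" and d: "dist x y \<le> c * ?q\<^sup>2"
    using c(1) pd_star_le_iff[of \<Gamma> x y c] by (auto dest: less_imp_le)
  have q: "0 \<le> ?q" using cos_psi_star[OF x \<open>x \<noteq> y\<close>] by metis
  \<comment> \<open>The chain \<open>dist x y \<le> c * ?q^2 \<le> 2 * r * ?q^2 \<le> 2 * r * ?q
    \<le> dist x y\<close> closes up, so equality holds throughout.\<close>
  have "c * ?q\<^sup>2 \<le> 2 * r * ?q\<^sup>2" using c(2) by (intro mult_right_mono) auto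
  moreover have "2 * r * ?q\<^sup>2 \<le> 2 * r * ?q"
    using r q by (intro mult_left_mono) (auto simp: power2_eq_square mult_left_le_one_le)
  moreover have "2 * r * ?q \<le> dist x y"
    by (rule cos_psi_star_le[OF r x y \<open>x \<noteq> y\<close>])
  ultimately have "c * ?q\<^sup>2 = 2 * r * ?q\<^sup>2"
    using d by linarith
  moreover have "0 < dist x y" using \<open>x \<noteq> y\<close> by simp
  with d have "?q\<^sup>2 \<noteq> 0" by auto
  ultimately have "c = 2 * r" by simp
  then show False using c(2) by simp
qed

text \<open>Lower semicontinuity of \<open>pd_star\<close>, which suffices for a minimum. Continuity
  may fail at endpoints, where the normal cone grows from a plane to a halfspace.\<close>

lemma pd_star_limit:
  assumes X: "\<And>k. X k \<in> L" "X \<longlonglongrightarrow> x" and Y: "\<And>k. Y k \<in> L" "Y \<longlonglongrightarrow> y"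
    and c: "c \<longlonglongrightarrow> a" and pd: "\<And>k. pd_star \<Gamma> (X k) (Y k) \<le> ereal (c k)"
  shows "pd_star \<Gamma> x y \<le> ereal a"
proof -
  obtain r where r: "0 < r" "unique_nearest L r" using positive_reach .
  have x: "x \<in> L" using closed_sequentially[OF closed_curve] X by blast
  have ne: "X k \<noteq> Y k" and d: "dist (X k) (Y k) \<le> c k * (cos (psi_star \<Gamma> (X k) (Y k)))\<^sup>2" for k
    using pd[of k] by (simp_all add: pd_star_le_iff)
  \<comment> \<open>Collapse to the diagonal is excluded: \<open>?q \<le> ?d / (2 * r)\<close> and
    \<open>?d \<le> c k * ?q^2\<close> bound the product of \<open>c k\<close> and the distance from
    below, also in the limit.\<close>
  have "4 * r\<^sup>2 \<le> c k * dist (X k) (Y k)" for k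
  proof -
    let ?q = "cos (psi_star \<Gamma> (X k) (Y k))" and ?d = "dist (X k) (Y k)"
    have "0 < ?d" using ne by simp
    then have "0 < c k * ?q\<^sup>2" using d[of k] by linarith
    then have "0 < c k" by (simp add: zero_less_mult_iff)
    have "0 \<le> ?q" using cos_psi_star[OF X(1) ne] by metis
    then have "(2 * r * ?q)\<^sup>2 \<le> ?d\<^sup>2"
      using cos_psi_star_le[OF r(2,1) X(1) Y(1) ne] r by (intro power_mono) auto
    then have "c k * (4 * r\<^sup>2 * ?q\<^sup>2) \<le> c k * ?d\<^sup>2"
      using \<open>0 < c k\<close> by (intro mult_left_mono) (auto simp: power_mult_distrib)
    moreover have "4 * r\<^sup>2 * ?d \<le> 4 * r\<^sup>2 * (c k * ?q\<^sup>2)"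
      using d by (intro mult_left_mono) auto
    ultimately have "4 * r\<^sup>2 * ?d \<le> (c k * ?d) * ?d"
      by (simp add: power2_eq_square mult_ac)
    then show ?thesis using \<open>0 < ?d\<close> by (rule mult_right_le_imp_le)
  qed
  moreover have "(\<lambda>k. c k * dist (X k) (Y k)) \<longlonglongrightarrow> a * dist x y"
    by (intro tendsto_intros c X Y)
  ultimately have "4 * r\<^sup>2 \<le> a * dist x y"
    by (intro tendsto_lowerbound[where F=sequentially]) auto
  with r have "x \<noteq> y" by auto
  have "\<exists>n. norm n = 1 \<and> normal_at \<Gamma> (X k) n \<and> 0 \<le> n \<bullet> (Y k - X k) \<and>
      cos (psi_star \<Gamma> (X k) (Y k)) = n \<bullet> (Y k - X k) / dist (X k) (Y k)" for k
    using cos_psi_star[OF X(1) ne] ne[of k]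
    by (metis zero_le_divide_iff zero_less_dist_iff not_le)
  then obtain N where N: "\<And>k. norm (N k) = 1" "\<And>k. normal_at \<Gamma> (X k) (N k)"
    "\<And>k. 0 \<le> N k \<bullet> (Y k - X k)"
    "\<And>k. cos (psi_star \<Gamma> (X k) (Y k)) = N k \<bullet> (Y k - X k) / dist (X k) (Y k)"
    by metis
  have "seq_compact (sphere (0 :: real^3) 1)" by (simp add: compact_imp_seq_compact)
  moreover have "\<forall>k. N k \<in> sphere 0 1" using N(1) by simp
  ultimately obtain n f where n: "n \<in> sphere 0 1" and f: "strict_mono f" "(N \<circ> f) \<longlonglongrightarrow> n"
    unfolding seq_compact_def by metis
  have Xf: "(X \<circ> f) \<longlonglongrightarrow> x" and Yf: "(Y \<circ> f) \<longlonglongrightarrow> y" and cf: "(c \<circ> f) \<longlonglongrightarrow> a"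
    using X(2) Y(2) c f(1) LIMSEQ_subseq_LIMSEQ by blast+
  \<comment> \<open>The limit of the optimal normals need not be optimal at \<open>x\<close>, but as
    a competitor it bounds the cosine there from below.\<close>
  have "normal_at \<Gamma> x n"
    using normal_at_closed[OF _ Xf _ f(2)] X(1) N(2) by simp
  have "dist x y \<le> a * (n \<bullet> (y - x) / dist x y)\<^sup>2"
  proof (rule tendsto_le)
    show "(\<lambda>k. dist ((X \<circ> f) k) ((Y \<circ> f) k)) \<longlonglongrightarrow> dist x y"
      by (intro tendsto_intros Xf Yf)
    show "(\<lambda>k. (c \<circ> f) k * ((N \<circ> f) k \<bullet> ((Y \<circ> f) k - (X \<circ> f) k) / dist ((X \<circ> f) k) ((Y \<circ> f) k))\<^sup>2)
        \<longlonglongrightarrow> a * (n \<bullet> (y - x) / dist x y)\<^sup>2"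
      using \<open>x \<noteq> y\<close> by (intro tendsto_intros Xf Yf cf f(2)) auto
    show "\<forall>\<^sub>F k in sequentially. dist ((X \<circ> f) k) ((Y \<circ> f) k) \<le>
        (c \<circ> f) k * ((N \<circ> f) k \<bullet> ((Y \<circ> f) k - (X \<circ> f) k) / dist ((X \<circ> f) k) ((Y \<circ> f) k))\<^sup>2"
      using d by (simp add: N(4)[symmetric])
  qed simp
  also have "\<dots> \<le> a * (cos (psi_star \<Gamma> x y))\<^sup>2"
  proof (intro mult_left_mono power_mono)
    show "n \<bullet> (y - x) / dist x y \<le> cos (psi_star \<Gamma> x y)"
      using cos_psi_star[OF x \<open>x \<noteq> y\<close>] \<open>normal_at \<Gamma> x n\<close> n by (metis dist_0_norm mem_sphere)
    have "0 \<le> n \<bullet> (y - x)"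
    proof (rule tendsto_lowerbound)
      show "(\<lambda>k. (N \<circ> f) k \<bullet> ((Y \<circ> f) k - (X \<circ> f) k)) \<longlonglongrightarrow> n \<bullet> (y - x)"
        by (intro tendsto_intros Xf Yf f(2))
    qed (use N(3) in auto)
    then show "0 \<le> n \<bullet> (y - x) / dist x y" by simp
    have "0 < a * dist x y" using \<open>4 * r\<^sup>2 \<le> a * dist x y\<close> r by (smt (verit) zero_less_power)
    then show "0 \<le> a" by (simp add: zero_less_mult_iff)
  qed
  finally show ?thesis using \<open>x \<noteq> y\<close> by (simp add: pd_star_le_iff)
qed

lemma attains_Inf_pd_star: "attains_Inf (\<lambda>(x, y). pd_star \<Gamma> x y) (L \<times> L)"
proof -
  let ?f = "\<lambda>(x, y). pd_star \<Gamma> x y"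
  define M where "M = (INF z\<in>L \<times> L. ?f z)"
  show ?thesis
  proof (cases M)
    case PInf
    obtain x where "x \<in> L" using curve_nonempty by blast
    then have "M \<le> ?f (x, x)" unfolding M_def by (intro INF_lower) auto
    with PInf \<open>x \<in> L\<close> show ?thesis
      unfolding attains_Inf_def M_def[symmetric] by (intro bexI[of _ "(x, x)"]) auto
  next
    case MInf
    then have "M < ereal (- 1)" by simp
    then obtain x y where "pd_star \<Gamma> x y < ereal (- 1)"
      by (auto simp: M_def INF_less_iff)
    then have "x \<noteq> y \<and> dist x y \<le> - 1 * (cos (psi_star \<Gamma> x y))\<^sup>2"
      unfolding pd_star_le_iff[symmetric] by (rule less_imp_le)
    then have False
      by (smt (verit) zero_le_power2 zero_less_dist_iff)
    then show ?thesis ..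
  next
    case (real m)
    have "\<exists>z\<in>L \<times> L. ?f z < ereal (m + 1 / Suc k)" for k
    proof -
      have "M < ereal (m + 1 / Suc k)" using real by simp
      then show ?thesis by (simp add: M_def INF_less_iff)
    qed
    then obtain Z where Z: "\<And>k. Z k \<in> L \<times> L" "\<And>k. ?f (Z k) < ereal (m + 1 / Suc k)" by metis
    have "seq_compact (L \<times> L)"
      by (intro compact_imp_seq_compact compact_Times compact_curve)
    then obtain z g where z: "z \<in> L \<times> L" and g: "strict_mono g" "(Z \<circ> g) \<longlonglongrightarrow> z"
      using Z(1) unfolding seq_compact_def by metis
    have "(\<lambda>k. m + 1 / real (Suc k)) \<longlonglongrightarrow> m + 0"
      by (intro tendsto_intros LIMSEQ_Suc[OF lim_1_over_n])
    then have "((\<lambda>k. m + 1 / real (Suc k)) \<circ> g) \<longlonglongrightarrow> m"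
      using g(1) LIMSEQ_subseq_LIMSEQ by fastforce
    then have "pd_star \<Gamma> (fst z) (snd z) \<le> ereal m"
    proof (rule pd_star_limit[rotated 4])
      show "(\<lambda>k. fst ((Z \<circ> g) k)) \<longlonglongrightarrow> fst z" "(\<lambda>k. snd ((Z \<circ> g) k)) \<longlonglongrightarrow> snd z"
        using g(2) by (rule tendsto_fst, rule tendsto_snd)
      show "fst ((Z \<circ> g) k) \<in> L" "snd ((Z \<circ> g) k) \<in> L" for k
        using Z(1)[of "g k"] by (auto simp: mem_Times_iff)
      show "pd_star \<Gamma> (fst ((Z \<circ> g) k)) (snd ((Z \<circ> g) k)) \<le> ereal (((\<lambda>k. m + 1 / real (Suc k)) \<circ> g) k)" for k
        using Z(2)[of "g k"] by (simp add: case_prod_beta less_imp_le)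
    qed
    moreover have "M \<le> ?f z" unfolding M_def using z by (intro INF_lower)
    ultimately show ?thesis
      unfolding attains_Inf_def M_def[symmetric] using z real
      by (intro bexI[OF _ z]) (auto simp: case_prod_beta intro: antisym)
  qed
qed

section \<open>Osculating circles\<close>

text \<open>In the direction of the curvature vector the curve rises at least like
  \<open>q * (t - s)^2 / 2\<close> with \<open>q\<close> just below the curvature, while its chord
  is at most \<open>\<bar>t - s\<bar>\<close>. The tangent ball condition then forces
  \<open>r * q \<le> 1\<close>.\<close>

lemma curvature_bound:
  assumes r: "unique_nearest L r" "0 < r" and C: "C \<in> \<Gamma>" and s: "s \<in> comp_dom C"
    and diff: "comp_tangent C differentiable (at s within comp_dom C)"
  shows "r * norm (comp_curvature C s) \<le> 1"
proof (rule ccontr)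
  let ?\<gamma> = "comp_point C" and ?T = "comp_tangent C" and ?\<kappa> = "comp_curvature C s"
  assume "\<not> ?thesis"
  then have neg: "1 < r * norm ?\<kappa>" by simp
  then have "?\<kappa> \<noteq> 0" by auto
  define n where "n = sgn ?\<kappa>"
  have n: "norm n = 1" "n \<bullet> ?\<kappa> = norm ?\<kappa>" "n \<bullet> ?T s = 0"
    using \<open>?\<kappa> \<noteq> 0\<close> curvature_orthogonal[OF component[OF C] s diff]
    by (auto simp: n_def norm_sgn sgn_div_norm dot_square_norm power2_eq_square)
  \<comment> \<open>Half of the excess over \<open>1 / r\<close>, so that
    \<open>norm ?\<kappa> - e\<close> still exceeds \<open>1 / r\<close>.\<close>
  define e where "e = (norm ?\<kappa> - 1 / r) / 2"
  have e: "0 < e" "1 < r * (norm ?\<kappa> - e)"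
    using neg r(2) by (auto simp: e_def field_simps)
  define q where "q = norm ?\<kappa> - e"
  have "((\<lambda>t. n \<bullet> ?T t) has_vector_derivative n \<bullet> ?\<kappa>) (at s within comp_dom C)"
    using bounded_linear.has_vector_derivative[OF bounded_linear_inner_right
        tangent_has_derivative[OF component[OF C] diff]] .
  then have "((\<lambda>t. n \<bullet> ?T t) has_derivative (\<lambda>h. h * norm ?\<kappa>)) (at s within comp_dom C)"
    by (simp add: has_vector_derivative_def n)
  then obtain d where "0 < d" and d: "\<And>t. t \<in> comp_dom C \<Longrightarrow> \<bar>t - s\<bar> < d \<Longrightarrow>
      \<bar>n \<bullet> ?T t - (t - s) * norm ?\<kappa>\<bar> \<le> e * \<bar>t - s\<bar>"
    using e(1) by (auto simp: has_derivative_within_alt n(3))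
  have slope: "0 \<le> (t - s) * (n \<bullet> ?T t - q * (t - s))" if t: "t \<in> comp_dom C" "\<bar>t - s\<bar> < d" for t
  proof -
    have "\<bar>(t - s) * (n \<bullet> ?T t - (t - s) * norm ?\<kappa>)\<bar> \<le> \<bar>t - s\<bar> * (e * \<bar>t - s\<bar>)"
      unfolding abs_mult using d[OF t] by (rule mult_left_mono) simp
    also have "\<dots> = e * (t - s)\<^sup>2"
      by (simp add: power2_eq_square flip: abs_mult)
    finally show ?thesis
      by (simp add: q_def algebra_simps power2_eq_square abs_le_iff)
  qed
  obtain a b where ab: "a < b" "{a..b} \<subseteq> comp_dom C" "\<And>t. t \<in> {a..b} \<Longrightarrow> \<bar>t - s\<bar> < d"
    using interval_near_parameter[OF component[OF C] s \<open>0 < d\<close>] by blast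
  obtain t where t: "t \<in> comp_dom C" "t \<noteq> s" "\<bar>t - s\<bar> < d"
  proof (cases "a = s")
    case True
    have "b \<in> comp_dom C" "b \<in> {a..b}" "b \<noteq> s" using ab(1,2) True by auto
    then show ?thesis using that[of b] ab(3) by blast
  next
    case False
    have "a \<in> comp_dom C" "a \<in> {a..b}" using ab(1,2) by auto
    then show ?thesis using that[of a] ab(3) False by blast
  qed
  \<comment> \<open>The tangent is known to be differentiable only at \<open>s\<close>, so a
    second-order Taylor formula is replaced by the mean value theorem for the difference to a
    parabola.\<close>
  have "((\<lambda>u. n \<bullet> ?\<gamma> u - q * (u - s)\<^sup>2 / 2) has_real_derivative n \<bullet> ?T u - q * (u - s)) (at u within comp_dom C)"
    if "u \<in> comp_dom C" for u
  proof -
    have "((\<lambda>u. n \<bullet> ?\<gamma> u) has_real_derivative n \<bullet> ?T u) (at u within comp_dom C)"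
      using bounded_linear.has_vector_derivative[OF bounded_linear_inner_right
          point_has_derivative[OF component[OF C] that]]
      by (simp add: has_real_derivative_iff_has_vector_derivative)
    moreover have "((\<lambda>u. q * (u - s)\<^sup>2 / 2) has_real_derivative q * (u - s)) (at u within comp_dom C)"
      by (auto intro!: derivative_eq_intros)
    ultimately show ?thesis by (rule DERIV_diff)
  qed
  from MVT_within[OF convex_comp_dom s t(1) this]
  obtain \<xi> where \<xi>: "\<xi> \<in> comp_dom C" "\<bar>\<xi> - s\<bar> \<le> \<bar>t - s\<bar>" "0 \<le> (t - s) * (\<xi> - s)"
    and mvt: "n \<bullet> ?\<gamma> t - q * (t - s)\<^sup>2 / 2 - (n \<bullet> ?\<gamma> s - q * (s - s)\<^sup>2 / 2)
      = (t - s) * (n \<bullet> ?T \<xi> - q * (\<xi> - s))" by metis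
  have "0 \<le> (t - s) * (n \<bullet> ?T \<xi> - q * (\<xi> - s))"
  proof (cases "\<xi> = s")
    case False
    moreover have "0 \<le> (\<xi> - s) * (n \<bullet> ?T \<xi> - q * (\<xi> - s))"
      using slope[OF \<xi>(1)] \<xi>(2) t(3) by simp
    ultimately show ?thesis using \<xi>(3) t(2) by (auto simp: zero_le_mult_iff)
  qed (simp add: n)
  then have "q * (t - s)\<^sup>2 \<le> 2 * (n \<bullet> (?\<gamma> t - ?\<gamma> s))"
    using mvt by (simp add: inner_diff_right)
  then have "r * (q * (t - s)\<^sup>2) \<le> r * (2 * (n \<bullet> (?\<gamma> t - ?\<gamma> s)))"
    using r(2) by (intro mult_left_mono) auto
  also have "\<dots> = 2 * r * (n \<bullet> (?\<gamma> t - ?\<gamma> s))" by simp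
  also have "\<dots> \<le> (norm (?\<gamma> t - ?\<gamma> s))\<^sup>2"
    by (rule tangent_ball_condition[OF r point_in_curve[OF C s]
        point_with_orthogonal_normal[OF C s n(3)] n(1) point_in_curve[OF C t(1)]])
  also have "\<dots> \<le> \<bar>t - s\<bar>\<^sup>2"
    by (intro power_mono speed_le[OF component[OF C] s t(1)]) simp
  finally have "(r * q) * (t - s)\<^sup>2 \<le> 1 * (t - s)\<^sup>2" by (simp add: mult.assoc)
  then have "r * q \<le> 1" using t(2) by (simp add: mult_le_cancel_right)
  with e(2) show False by (simp add: q_def)
qed

lemma OscE:
  assumes "c \<in> Osc \<Gamma>"
  obtains C s where "C \<in> \<Gamma>" "s \<in> comp_dom C" "comp_tangent C differentiable (at s within comp_dom C)"
    "c = (comp_point C s, comp_tangent C s, comp_curvature C s)"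
  using assms unfolding Osc_def by blast

lemma Osc_subset_Circ: "Osc \<Gamma> \<subseteq> Circ"
proof
  fix c assume "c \<in> Osc \<Gamma>"
  then show "c \<in> Circ"
    by (elim OscE) (simp add: Circ_def norm_tangent component curvature_orthogonal)
qed

lemma closed_Osc_eq: "closed_Osc \<Gamma> = closure (Osc \<Gamma>)"
proof -
  have "closed_Osc \<Gamma> = Circ \<inter> closure (Circ \<inter> Osc \<Gamma>)"
    by (simp add: closed_Osc_def closure_of_subtopology)
  moreover have "closure (Osc \<Gamma>) \<subseteq> Circ"
    using Osc_subset_Circ closed_Circ by (rule closure_minimal)
  ultimately show ?thesis
    using Osc_subset_Circ by (metis inf.absorb2)
qed

lemma closed_Osc_norm_le:
  assumes "\<And>c. c \<in> Osc \<Gamma> \<Longrightarrow> a * norm (snd (snd c)) \<le> b" and c: "c \<in> closed_Osc \<Gamma>"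
  shows "a * norm (snd (snd c)) \<le> b"
proof -
  have "closed {c :: pointed_circle. a * norm (snd (snd c)) \<le> b}"
    by (intro closed_Collect_le continuous_intros)
  then have "closure (Osc \<Gamma>) \<subseteq> {c. a * norm (snd (snd c)) \<le> b}"
    using assms(1) by (intro closure_minimal) auto
  with c show ?thesis by (auto simp: closed_Osc_eq)
qed

lemma closed_Osc_radius_ge:
  assumes r: "unique_nearest L r" "0 < r" and c: "c \<in> closed_Osc \<Gamma>"
  shows "ereal r \<le> circ_radius c"
  unfolding circ_radius_ge_iff[OF r(2)]
proof (rule closed_Osc_norm_le[OF _ c])
  fix c assume "c \<in> Osc \<Gamma>"
  then show "r * norm (snd (snd c)) \<le> 1"
    using curvature_bound[OF r] by (elim OscE) simp
qed

lemma closed_Osc_base_point: "c \<in> closed_Osc \<Gamma> \<Longrightarrow> base_point c \<in> L"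
proof -
  have "closure (Osc \<Gamma>) \<subseteq> fst -` L"
    by (intro closure_minimal closed_vimage closed_curve continuous_intros)
      (auto elim!: OscE intro: point_in_curve)
  then show "c \<in> closed_Osc \<Gamma> \<Longrightarrow> base_point c \<in> L"
    by (auto simp: closed_Osc_eq base_point_eq)
qed

text \<open>A positive reach bounds all curvatures.\<close>

lemma compact_closed_Osc: "compact (closed_Osc \<Gamma>)"
proof -
  obtain r where r: "0 < r" "unique_nearest L r" using positive_reach .
  have "Osc \<Gamma> \<subseteq> L \<times> sphere 0 1 \<times> cball 0 (1 / r)"
  proof
    fix c assume "c \<in> Osc \<Gamma>"
    then show "c \<in> L \<times> sphere 0 1 \<times> cball 0 (1 / r)"
      using curvature_bound[OF r(2,1)] r(1)
      by (elim OscE) (simp add: norm_tangent component point_in_curve pos_le_divide_eq mult.commute)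
  qed
  moreover have "compact (L \<times> sphere (0 :: real^3) 1 \<times> cball (0 :: real^3) (1 / r))"
    by (intro compact_Times compact_curve compact_sphere compact_cball)
  ultimately have "bounded (Osc \<Gamma>)"
    using bounded_subset compact_imp_bounded by blast
  then show ?thesis by (simp add: closed_Osc_eq compact_closure)
qed

lemma twice_differentiable_near:
  assumes C: "C \<in> \<Gamma>" and s: "s \<in> comp_dom C" and "0 < e"
  obtains t where "t \<in> comp_dom C" "\<bar>t - s\<bar> < e"
    "comp_tangent C differentiable (at t within comp_dom C)"
proof -
  obtain a b where ab: "a < b" "{a..b} \<subseteq> comp_dom C" "\<And>t. t \<in> {a..b} \<Longrightarrow> \<bar>t - s\<bar> < e"
    using interval_near_parameter[OF component[OF C] s \<open>0 < e\<close>] by blast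
  obtain K where "K-lipschitz_on (comp_dom C) (comp_tangent C)"
    using component[OF C] by (auto simp: c11_component_def)
  then have "K-lipschitz_on {a..b} (comp_tangent C)"
    using ab(2) by (rule lipschitz_on_subset)
  then obtain t where "a < t" "t < b" "comp_tangent C differentiable (at t)"
    using lipschitz_differentiability_dense ab(1) by blast
  with ab show ?thesis
    by (intro that[of t]) (auto intro: differentiable_at_withinI)
qed

text \<open>The tangent may fail to be differentiable at \<open>x\<close>, but it is at nearby
  parameters; the base points form a closed set, as the image of a compact one.\<close>

lemma closed_Osc_fiber_nonempty:
  assumes "x \<in> L"
  shows "{c \<in> closed_Osc \<Gamma>. base_point c = x} \<noteq> {}"
proof -
  obtain C s where C: "C \<in> \<Gamma>" and s: "s \<in> comp_dom C" "comp_point C s = x"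
    using parameter_exists[OF assms] .
  have "closed (fst ` closed_Osc \<Gamma>)"
    by (intro compact_imp_closed compact_continuous_image compact_closed_Osc continuous_intros)
  moreover have "x \<in> closure (fst ` closed_Osc \<Gamma>)"
    unfolding closure_approachable
  proof (intro allI impI)
    fix e :: real assume "0 < e"
    then obtain t where t: "t \<in> comp_dom C" "\<bar>t - s\<bar> < e"
      "comp_tangent C differentiable (at t within comp_dom C)"
      using twice_differentiable_near[OF C s(1)] by blast
    have "(comp_point C t, comp_tangent C t, comp_curvature C t) \<in> closed_Osc \<Gamma>"
      unfolding closed_Osc_eq using t C closure_subset by (fastforce simp: Osc_def)
    then have "comp_point C t \<in> fst ` closed_Osc \<Gamma>" by force
    moreover have "dist (comp_point C t) x < e"
      using speed_le[OF component[OF C] s(1) t(1)] s(2) t(2) by (simp add: dist_norm)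
    ultimately show "\<exists>y\<in>fst ` closed_Osc \<Gamma>. dist y x < e" by blast
  qed
  ultimately have "x \<in> fst ` closed_Osc \<Gamma>" by simp
  then show ?thesis unfolding base_point_eq by blast
qed

lemma closed_Osc_nonempty: "closed_Osc \<Gamma> \<noteq> {}"
  using closed_Osc_fiber_nonempty curve_nonempty by blast

lemma compact_closed_Osc_fiber: "compact {c \<in> closed_Osc \<Gamma>. base_point c = x}"
proof -
  have "{c \<in> closed_Osc \<Gamma>. base_point c = x} = closed_Osc \<Gamma> \<inter> {c. fst c = x}"
    by (auto simp: base_point_eq)
  also have "compact \<dots>"
    by (intro compact_Int_closed compact_closed_Osc closed_Collect_eq continuous_intros)
  finally show ?thesis .
qed

lemma INF_rho: "(INF x\<in>L. rho \<Gamma> x) = (INF c\<in>closed_Osc \<Gamma>. circ_radius c)"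
proof (rule antisym)
  show "(INF x\<in>L. rho \<Gamma> x) \<le> (INF c\<in>closed_Osc \<Gamma>. circ_radius c)"
  proof (rule INF_greatest)
    fix c assume c: "c \<in> closed_Osc \<Gamma>"
    have "(INF x\<in>L. rho \<Gamma> x) \<le> rho \<Gamma> (base_point c)"
      using closed_Osc_base_point[OF c] by (rule INF_lower)
    also have "\<dots> \<le> circ_radius c"
      unfolding rho_def using c by (intro INF_lower) simp
    finally show "(INF x\<in>L. rho \<Gamma> x) \<le> circ_radius c" .
  qed
  show "(INF c\<in>closed_Osc \<Gamma>. circ_radius c) \<le> (INF x\<in>L. rho \<Gamma> x)"
    unfolding rho_def by (intro INF_greatest INF_lower) simp
qed

lemma attains_Inf_rho: "attains_Inf (rho \<Gamma>) L"
proof -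
  obtain c where c: "c \<in> closed_Osc \<Gamma>" "circ_radius c = (INF c\<in>closed_Osc \<Gamma>. circ_radius c)"
    using attains_Inf_circ_radius[OF compact_closed_Osc closed_Osc_nonempty]
    by (auto simp: attains_Inf_def)
  have "rho \<Gamma> (base_point c) \<le> circ_radius c"
    unfolding rho_def using c(1) by (intro INF_lower) simp
  with c(2) have "rho \<Gamma> (base_point c) \<le> (INF x\<in>L. rho \<Gamma> x)" by (simp add: INF_rho)
  moreover have "(INF x\<in>L. rho \<Gamma> x) \<le> rho \<Gamma> (base_point c)"
    using closed_Osc_base_point[OF c(1)] by (rule INF_lower)
  ultimately show ?thesis
    unfolding attains_Inf_def using closed_Osc_base_point[OF c(1)] antisym by blast
qed

section \<open>The reach as a supremum, and the reach formula\<close>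

lemma unique_nearest_less_reach:
  assumes "ereal r < reach L"
  shows "unique_nearest L r"
proof -
  obtain R where R: "ereal r < R"
    "\<And>p. ereal (infdist p L) < R \<Longrightarrow> \<exists>!q. q \<in> L \<and> dist p q = infdist p L"
    using assms unfolding reach_def less_Sup_iff by blast
  show ?thesis
    unfolding unique_nearest_def
  proof (intro allI impI R(2))
    fix p assume "infdist p L < r"
    then show "ereal (infdist p L) < R"
      using R(1) by (meson ereal_less_eq(3) less_ereal.simps(1) order_less_trans)
  qed
qed

lemma reach_geI: "0 \<le> r \<Longrightarrow> unique_nearest L r \<Longrightarrow> ereal r \<le> reach L"
  unfolding reach_def unique_nearest_def by (intro Sup_upper) simp

text \<open>Each existing derivative of the tangent inside an interval is the curvature of a circle
  in \<open>Osc \<Gamma>\<close>, so the given constant \<open>K\<close> improves to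
  \<open>k\<close>.\<close>

lemma lipschitz_from_curvature:
  assumes k: "\<And>c. c \<in> Osc \<Gamma> \<Longrightarrow> norm (snd (snd c)) \<le> k" and C: "C \<in> \<Gamma>"
  shows "k-lipschitz_on (comp_dom C) (comp_tangent C)"
proof -
  obtain K where K: "K-lipschitz_on (comp_dom C) (comp_tangent C)"
    using component[OF C] by (auto simp: c11_component_def)
  have bound: "norm (comp_tangent C b - comp_tangent C a) \<le> k * (b - a)"
    if ab: "a \<in> comp_dom C" "b \<in> comp_dom C" "a \<le> b" for a b
  proof -
    have sub: "{a..b} \<subseteq> comp_dom C"
      using closed_segment_subset[OF ab(1,2) convex_comp_dom] ab(3)
      by (simp add: closed_segment_eq_real_ivl)
    show ?thesis
    proof (rule lipschitz_bound_from_derivative[OF lipschitz_on_subset[OF K sub] ab(3)])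
      fix x D assume x: "a < x" "x < b" "(comp_tangent C has_vector_derivative D) (at x)"
      then have dom: "x \<in> comp_dom C" and D: "(comp_tangent C has_vector_derivative D) (at x within comp_dom C)"
        using sub by (auto intro: has_vector_derivative_at_within)
      have "(comp_point C x, comp_tangent C x, D) \<in> Osc \<Gamma>"
        using C dom D curvature_eq[OF component[OF C] dom D] differentiableI_vector
        unfolding Osc_def by blast
      from k[OF this] show "norm D \<le> k" by simp
    qed
  qed
  obtain c where "c \<in> Osc \<Gamma>"
    using closed_Osc_nonempty by (auto simp: closed_Osc_eq)
  show ?thesis
  proof (rule lipschitz_onI)
    show "0 \<le> k" using k[OF \<open>c \<in> Osc \<Gamma>\<close>] norm_ge_zero order_trans by blast
    fix a b assume "a \<in> comp_dom C" "b \<in> comp_dom C"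
    then show "dist (comp_tangent C a) (comp_tangent C b) \<le> k * dist a b"
      using bound[of a b] bound[of b a]
      by (cases a b rule: le_cases) (auto simp: dist_norm dist_real_def norm_minus_commute)
  qed
qed

text \<open>
  At the level of the reach, two distinct nearest points of a common center must be antipodal,
  so that they realize the penalized distance.
\<close>

lemma antipodal_pair_at_reach:
  assumes reach: "reach L = ereal r" and r: "0 < r"
    and m: "r < m" "\<And>c. c \<in> closed_Osc \<Gamma> \<Longrightarrow> ereal m \<le> circ_radius c"
  obtains x y where "x \<in> L" "y \<in> L" "pd_star \<Gamma> x y \<le> ereal (2 * r)"
proof -
  have "norm (snd (snd c)) \<le> 1 / m" if "c \<in> Osc \<Gamma>" for c
    using m(2)[of c] that closure_subset[of "Osc \<Gamma>"] circ_radius_ge_iff[of m c] m(1) r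
    by (auto simp: closed_Osc_eq pos_le_divide_eq mult.commute)
  note K = lipschitz_from_curvature[OF this]
  \<comment> \<open>Room above \<open>r\<close> for the approximating centers, still below
    \<open>m\<close> so that feet remain separated.\<close>
  define m' where "m' = (r + m) / 2"
  have m': "r < m'" "1 / m * m' < 1"
    using m(1) r by (auto simp: m'_def field_simps)
  obtain \<epsilon> where "0 < \<epsilon>" and unique:
    "\<And>p x y. x \<in> L \<Longrightarrow> y \<in> L \<Longrightarrow> normal_at \<Gamma> x (p - x) \<Longrightarrow> normal_at \<Gamma> y (p - y) \<Longrightarrow>
      dist x p \<le> m' \<Longrightarrow> dist x y < \<epsilon> \<Longrightarrow> x = y"
    using normal_foot_unique[OF K m'(2)] by metis
  have below: "unique_nearest L r"
    unfolding unique_nearest_def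
  proof (intro allI impI)
    fix p assume "infdist p L < r"
    then obtain t where t: "infdist p L < t" "t < r" using dense by blast
    then have "unique_nearest L t"
      using unique_nearest_less_reach reach by simp
    with t(1) show "\<exists>!q. q \<in> L \<and> dist p q = infdist p L"
      by (simp add: unique_nearest_def)
  qed
  \<comment> \<open>Pairs of nearest points of the common center \<open>x + w\<close>. Using the
    bounded displacement \<open>w\<close> and the separation \<open>\<epsilon>\<close> makes
    \<open>A\<close> compact, with no degenerate limits.\<close>
  define A where "A = {(x, y, w). x \<in> L \<and> y \<in> L \<and> norm w \<le> m' \<and> dist (x + w) x = infdist (x + w) L \<and>
    dist (x + w) y = infdist (x + w) L \<and> \<epsilon> \<le> dist x y}"
  have mem_A: "(x, y, p - x) \<in> A"
    if "x \<in> L" "y \<in> L" "dist p x = infdist p L" "dist p y = infdist p L" "x \<noteq> y" "infdist p L \<le> m'" for x y p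
  proof -
    have "\<epsilon> \<le> dist x y"
      using unique[of x y p] that nearest_imp_normal by (metis dist_commute not_le)
    with that show ?thesis by (simp add: A_def dist_norm)
  qed
  have approx: "\<exists>(x, y, w)\<in>A. infdist (x + w) L < t" if t: "r < t" "t \<le> m'" for t
  proof -
    have "\<not> unique_nearest L t"
      using reach_geI[of t] t(1) r reach by auto
    then obtain p where p: "infdist p L < t" "\<not> (\<exists>!q. q \<in> L \<and> dist p q = infdist p L)"
      unfolding unique_nearest_def by blast
    then obtain x y where "x \<in> L" "y \<in> L" "dist p x = infdist p L" "dist p y = infdist p L" "x \<noteq> y"
      using nearest_point_exists[OF closed_curve curve_nonempty, of p] by blast
    with mem_A[of x y p] p(1) t(2) show ?thesis
      by (intro bexI[of _ "(x, y, p - x)"]) auto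
  qed
  have "compact A"
  proof -
    have "A = (L \<times> L \<times> cball 0 m') \<inter>
        ({z. dist (fst z + snd (snd z)) (fst z) = infdist (fst z + snd (snd z)) L} \<inter>
         {z. dist (fst z + snd (snd z)) (fst (snd z)) = infdist (fst z + snd (snd z)) L} \<inter>
         {z. \<epsilon> \<le> dist (fst z) (fst (snd z))})"
      by (auto simp: A_def)
    also have "compact \<dots>"
      by (intro compact_Int_closed compact_Times compact_curve compact_cball closed_Int
          closed_Collect_eq closed_Collect_le continuous_intros)
    finally show ?thesis .
  qed
  moreover have "A \<noteq> {}" using approx[of m'] m'(1) by auto
  moreover have "continuous_on A (\<lambda>z. infdist (fst z + snd (snd z)) L)"
    by (intro continuous_intros)
  ultimately obtain z where "z \<in> A" and z_min:
    "\<And>z'. z' \<in> A \<Longrightarrow> infdist (fst z + snd (snd z)) L \<le> infdist (fst z' + snd (snd z')) L"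
    using continuous_attains_inf[of A "\<lambda>z. infdist (fst z + snd (snd z)) L"] by blast
  define x y p where "x = fst z" and "y = fst (snd z)" and "p = x + snd (snd z)"
  have xy: "x \<in> L" "y \<in> L" "dist p x = infdist p L" "dist p y = infdist p L" "\<epsilon> \<le> dist x y"
    using \<open>z \<in> A\<close> by (auto simp: A_def x_def y_def p_def)
  then have "x \<noteq> y" using \<open>0 < \<epsilon>\<close> by auto
  \<comment> \<open>Failure of uniqueness at every level above \<open>r\<close> gives one
    inequality, uniqueness below \<open>r\<close> the other.\<close>
  have "infdist p L = r"
  proof (rule antisym)
    show "infdist p L \<le> r"
    proof (rule dense_ge_bounded[OF m'(1)])
      fix t assume "r < t" "t < m'"
      then obtain z' where "z' \<in> A" "infdist (fst z' + snd (snd z')) L < t"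
        using approx[of t] by fastforce
      with z_min[of z'] show "infdist p L \<le> t" by (simp add: p_def x_def)
    qed
    show "r \<le> infdist p L"
      using unique_nearestD[OF below _ xy(1,3,2,4)] \<open>x \<noteq> y\<close> by (meson not_le)
  qed
  have "p - x = - (p - y)"
  proof (rule isolated_nearest_points_antipodal[OF closed_curve below r \<open>infdist p L = r\<close>])
    fix q assume "q \<in> L" "dist p q = r" "dist q x < \<epsilon>"
    then show "q = x"
      using xy \<open>infdist p L = r\<close> m'(1)
      by (intro unique[of q x p] nearest_imp_normal) (auto simp: dist_commute)
  qed (use xy \<open>infdist p L = r\<close> \<open>x \<noteq> y\<close> \<open>0 < \<epsilon>\<close> in auto)
  then have v: "y - x = 2 *\<^sub>R (p - x)" by (simp add: scaleR_2 algebra_simps)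
  have "norm (p - x) = r" using xy \<open>infdist p L = r\<close> by (simp add: dist_norm)
  then have "dist x y = 2 * r" using v by (simp add: dist_norm norm_minus_commute[of x y])
  define n where "n = sgn (p - x)"
  have n: "norm n = 1" "normal_at \<Gamma> x n" "n \<bullet> (y - x) = dist x y"
  proof -
    show "norm n = 1" using \<open>norm (p - x) = r\<close> r by (auto simp: n_def norm_sgn)
    show "normal_at \<Gamma> x n"
      unfolding n_def sgn_div_norm using xy by (intro normal_at_scaleR nearest_imp_normal) auto
    show "n \<bullet> (y - x) = dist x y"
      using \<open>norm (p - x) = r\<close> r \<open>dist x y = 2 * r\<close>
      by (simp add: v n_def sgn_div_norm dot_square_norm power2_eq_square)
  qed
  \<comment> \<open>The normal \<open>n\<close> at \<open>x\<close> points straight at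
    \<open>y\<close>.\<close>
  have "1 \<le> cos (psi_star \<Gamma> x y)"
  proof -
    have "n \<bullet> (y - x) / dist x y \<le> cos (psi_star \<Gamma> x y)"
      using cos_psi_star[OF xy(1) \<open>x \<noteq> y\<close>] n(1,2) by metis
    then show ?thesis using \<open>x \<noteq> y\<close> by (simp add: n(3))
  qed
  then have "cos (psi_star \<Gamma> x y) = 1" using cos_le_one antisym by blast
  then have "pd_star \<Gamma> x y \<le> ereal (2 * r)"
    using \<open>x \<noteq> y\<close> \<open>dist x y = 2 * r\<close> by (simp add: pd_star_le_iff)
  with xy that show ?thesis by blast
qed

lemma half_ereal_le_iff: "ereal r \<le> 1/2 * X \<longleftrightarrow> ereal (2 * r) \<le> X"
  by (cases X) (auto simp: one_ereal_def numeral_eq_ereal ereal_divide)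

lemma reach_eq:
  "reach L = min (1/2 * (INF (x, y)\<in>L \<times> L. pd_star \<Gamma> x y)) (INF c\<in>closed_Osc \<Gamma>. circ_radius c)"
    (is "_ = min (1/2 * ?P) ?R")
proof (rule antisym)
  obtain r0 where r0: "0 < r0" "unique_nearest L r0" using positive_reach .
  have lower: "ereal r \<le> min (1/2 * ?P) ?R" if r: "unique_nearest L r" "0 < r" for r
    unfolding min.bounded_iff half_ereal_le_iff
    by (intro conjI INF_greatest) (auto intro: pd_star_ge[OF r] closed_Osc_radius_ge[OF r] simp del: circ_radius.simps)
  show "reach L \<le> min (1/2 * ?P) ?R"
  \<comment> \<open>The reach may be infinite, so it is approached from below; levels up to
    \<open>r0\<close>, also negative ones, are covered by \<open>r0\<close> itself.\<close>
  proof (rule dense_le)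
    fix y assume "y < reach L"
    show "y \<le> min (1/2 * ?P) ?R"
    proof (cases "y \<le> ereal r0")
      case True
      then show ?thesis using lower[OF r0(2,1)] by (rule order_trans)
    next
      case False
      with \<open>y < reach L\<close> obtain r where "y = ereal r" "r0 < r" by (cases y) auto
      with \<open>y < reach L\<close> r0(1) show ?thesis
        using lower unique_nearest_less_reach by simp
    qed
  qed
  show "min (1/2 * ?P) ?R \<le> reach L"
  proof (rule ccontr)
    assume "\<not> ?thesis"
    \<comment> \<open>The strict bound by the radii makes the reach finite and leaves room for
      \<open>m\<close>; the resulting antipodal pair contradicts the other bound.\<close>
    then have less: "reach L < 1/2 * ?P" "reach L < ?R" by (auto simp: not_le)
    have "ereal r0 \<le> reach L" using r0 by (intro reach_geI) auto
    with less obtain r where r: "reach L = ereal r" "0 < r"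
      using r0(1) by (cases "reach L") auto
    obtain m where m: "ereal r < ereal m" "ereal m < ?R"
      using ereal_dense2 less(2) r(1) by metis
    have "ereal m \<le> circ_radius c" if "c \<in> closed_Osc \<Gamma>" for c
      using INF_lower[OF that, of circ_radius] m(2) by simp
    then obtain x y where xy: "x \<in> L" "y \<in> L" "pd_star \<Gamma> x y \<le> ereal (2 * r)"
      using antipodal_pair_at_reach[OF r] m(1) by (metis less_ereal.simps(1))
    have "?P \<le> pd_star \<Gamma> x y"
      using INF_lower[of "(x, y)" "L \<times> L" "\<lambda>(x, y). pd_star \<Gamma> x y"] xy by simp
    with xy(3) have "?P \<le> ereal (2 * r)" by simp
    then have "1/2 * ?P \<le> ereal r"
      by (cases ?P) (auto simp: one_ereal_def numeral_eq_ereal ereal_divide)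
    with less(1) r(1) show False by simp
  qed
qed

end

theorem proposition2p14:
  fixes L :: "(real^3) set" and \<Gamma> :: "component set"
  assumes "c11_curve \<Gamma> L"
  shows "(\<forall>x\<in>L. attains_Inf circ_radius {c \<in> closed_Osc \<Gamma>. base_point c = x}) \<and>
         attains_Inf (\<lambda>(x, y). pd_star \<Gamma> x y) (L \<times> L) \<and>
         attains_Inf (rho \<Gamma>) L \<and>
         attains_Inf circ_radius (closed_Osc \<Gamma>) \<and>
         reach L = min (1/2 * (INF (x, y)\<in>L \<times> L. pd_star \<Gamma> x y)) (INF x\<in>L. rho \<Gamma> x) \<and>
         reach L = min (1/2 * (INF (x, y)\<in>L \<times> L. pd_star \<Gamma> x y))
                       (INF c\<in>closed_Osc \<Gamma>. circ_radius c)"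
proof -
  interpret c11 \<Gamma> L using assms by unfold_locales
  show ?thesis
    using attains_Inf_circ_radius[OF compact_closed_Osc_fiber closed_Osc_fiber_nonempty]
      attains_Inf_pd_star attains_Inf_rho
      attains_Inf_circ_radius[OF compact_closed_Osc closed_Osc_nonempty] reach_eq
    by (simp add: INF_rho)
qed

end
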